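(* Define the polynomial sequence $\{w_n(x)\}_{n\ge 0}$ in $\mathbb{Z}[x]$ by $w_0(x)=1$, $w_1(x)=1$ and $w_n(x)=(x-2)w_{n-1}(x)-w_{n-2}(x)$ for $n\ge 2$. For each odd integer $d>1$ define $$\Omega_d(x)=\prod_{\substack{1\le m<d,\ m \text{ odd}\\ \gcd(m,d)=1}}\left(x-\left(e^{i\pi m/d}+e^{-i\pi m/d}+2\right)\right).$$ Then, for every $n\ge 2$, $$w_n(x)=\prod_{\substack{d\mid (2n-1)\\ d>1}}\Omega_d(x),$$ where each $\Omega_d(x)$ is (a polynomial in $\mathbb{Z}[x]$ that is) irreducible over $\mathbb{Q}$ and monogenic, of degree $|\mathrm{Gal}(\Omega_d)|=\phi(d)/2$. Furthermore, $\Omega_d(x)$ is cyclic with $\mathrm{Gal}(\Omega_d)\simeq C_{\phi(d)/2}$ if and only if $d$ satisfies Condition $\mathcal{C}$.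
   Context: $\phi$ is Euler's totient function and $C_N$ is the cyclic group of order $N$. For $f(x)\in\mathbb{Z}[x]$, $\mathrm{Gal}(f)$ denotes the Galois group of $f(x)$ over $\mathbb{Q}$. A monic polynomial $f(x)\in\mathbb{Z}[x]$ of degree $N$, irreducible over $\mathbb{Q}$, with $f(\theta)=0$, is called monogenic if $\{1,\theta,\theta^2,\ldots,\theta^{N-1}\}$ is a $\mathbb{Z}$-basis for the ring of integers of $\mathbb{Q}(\theta)$; it is called cyclic if $\mathrm{Gal}(f)\simeq C_N$. An integer $N\ge 2$ satisfies Condition $\mathcal{C}$ if $N\in\{2^a,\ p^a,\ 2p^a,\ 4p^a,\ p^aq^b,\ 2p^aq^b\}$ for some positive integers $a$ and $b$, and distinct odd primes $p$ and $q$ with $\gcd(\phi(p^a),\phi(q^b))=2$ (the gcd requirement being relevant to the forms involving both $p$ and $q$). *)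

theory Defs
  imports
    Complex_Main
    "HOL-Computational_Algebra.Polynomial"
    "HOL-Computational_Algebra.Factorial_Ring"
    "HOL-Number_Theory.Totient"
    "HOL-Algebra.Bij"
    "HOL-Algebra.Elementary_Groups"
    "HOL-Algebra.Generated_Fields"
    "HOL-Algebra.Algebraic_Closure_Type"
begin

fun w :: "nat \<Rightarrow> int poly" where
  "w 0 = 1"
| "w (Suc 0) = 1"
| "w (Suc (Suc n)) = ([:0, 1:] - 2) * w (Suc n) - w n"

definition Omega :: "nat \<Rightarrow> complex poly" where
  "Omega d = (\<Prod>m | 1 \<le> m \<and> m < d \<and> odd m \<and> coprime m d.
     [:0, 1:] - [: exp (\<i> * of_real pi * of_nat m / of_nat d)
                 + exp (- (\<i> * of_real pi * of_nat m / of_nat d)) + 2 :])"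

text \<open>All number fields are taken inside the complex numbers, as fields generated over
  the rationals by a set of complex numbers.\<close>

definition adjoin :: "complex set \<Rightarrow> complex set" where
  "adjoin S = generate_field ring_of_type_algebra (\<rat> \<union> S)"

definition ring_of_integers :: "complex set \<Rightarrow> complex set" where
  "ring_of_integers K = {z \<in> K. algebraic_int z}"

abbreviation int_scale :: "int \<Rightarrow> complex \<Rightarrow> complex" where
  "int_scale k z \<equiv> of_int k * z"

lemma module_int_scale: "Modules.module int_scale"
  by unfold_locales (simp_all add: algebra_simps)

definition Z_basis :: "complex set \<Rightarrow> complex set \<Rightarrow> bool" where
  "Z_basis B M \<longleftrightarrow> \<not> Modules.module.dependent int_scale B \<and> Modules.module.span int_scale B = M"

abbreviation irreducible_over_Q :: "int poly \<Rightarrow> bool" where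
  "irreducible_over_Q f \<equiv> Factorial_Ring.irreducible (map_poly (of_int :: int \<Rightarrow> rat) f)"

abbreviation complex_roots :: "int poly \<Rightarrow> complex set" where
  "complex_roots f \<equiv> {z. poly (map_poly of_int f) z = 0}"

text \<open>The condition is required for every root; an irreducible polynomial has at least one
  complex root, and all its roots are conjugate, so the choice of root is immaterial.\<close>

definition monogenic :: "int poly \<Rightarrow> bool" where
  "monogenic f \<longleftrightarrow> lead_coeff f = 1 \<and> irreducible_over_Q f \<and>
     (\<forall>\<theta> \<in> complex_roots f.
        Z_basis {\<theta> ^ i | i. i < Polynomial.degree f} (ring_of_integers (adjoin {\<theta>})))"

text \<open>The group of field automorphisms of the splitting field that fix the rationals.
  Following \<open>BijGroup\<close>, an automorphism is a function that is \<open>undefined\<close> outside the field.\<close>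

definition Gal :: "int poly \<Rightarrow> (complex \<Rightarrow> complex) monoid" where
  "Gal f = (let K = adjoin (complex_roots f); R = ring_of_type_algebra\<lparr>carrier := K\<rparr>
     in (BijGroup K)\<lparr>carrier := {\<sigma> \<in> Bij K. \<sigma> \<in> ring_hom R R \<and> (\<forall>x\<in>\<rat>. \<sigma> x = x)}\<rparr>)"

text \<open>\<open>integer_mod_group N\<close> is the cyclic group of order \<open>N\<close> for \<open>N > 0\<close>.\<close>

definition cyclic_poly :: "int poly \<Rightarrow> bool" where
  "cyclic_poly f \<longleftrightarrow> lead_coeff f = 1 \<and> irreducible_over_Q f \<and>
     Gal f \<cong> integer_mod_group (Polynomial.degree f)"

definition condition_C :: "nat \<Rightarrow> bool" where
  "condition_C N \<longleftrightarrow> N \<ge> 2 \<and>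
     ((\<exists>a>0. N = 2 ^ a) \<or>
      (\<exists>p a. Factorial_Ring.prime p \<and> odd p \<and> a > 0 \<and> (N = p ^ a \<or> N = 2 * p ^ a \<or> N = 4 * p ^ a)) \<or>
      (\<exists>p q a b. Factorial_Ring.prime p \<and> odd p \<and> Factorial_Ring.prime q \<and> odd q \<and> p \<noteq> q \<and> a > 0 \<and> b > 0 \<and>
         gcd (totient (p ^ a)) (totient (q ^ b)) = 2 \<and>
         (N = p ^ a * q ^ b \<or> N = 2 * p ^ a * q ^ b)))"

end

theory Submission
  imports
    Defs
    "HOL-Number_Theory.Residue_Primitive_Roots"
    "Jordan_Normal_Form.Char_Poly"
begin

text \<open>With \<open>\<eta> = exp (i\<pi>(d+1)/d)\<close>, a primitive \<open>d\<close>-th root of unity, the roots of \<open>Omega d\<close> are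
  \<open>\<theta>\<^sub>a = 2 - \<eta>\<^sup>a - \<eta>\<^sup>-\<^sup>a\<close> for \<open>a\<close> coprime to \<open>d\<close>. That the \<open>\<theta>\<^sub>a\<close> are conjugate is Landau's argument: for an
  integer polynomial \<open>h\<close> with \<open>h(\<eta>) = 0\<close>, \<open>h(\<eta>\<^sup>p) \<equiv> h(\<eta>)\<^sup>p = 0\<close> modulo \<open>p\<close>, so \<open>h(\<eta>\<^sup>p) = 0\<close> for all large
  primes \<open>p\<close>, and every class coprime to \<open>d\<close> contains a product of large primes.
  The ring \<open>\<int>[\<eta>]\<close> is integrally closed because for every prime \<open>p\<close> it contains some \<open>\<pi>\<close>
  with \<open>\<pi>\<^sup>e\<close> associated to \<open>p\<close> such that \<open>x\<^sup>q \<equiv> x\<close> modulo \<open>\<pi>\<close> for arbitrarily large \<open>q\<close>, namely \<open>\<pi> = p\<close>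
  or \<open>\<pi> = 1 - \<zeta>\<close> with \<open>\<zeta>\<close> of order the \<open>p\<close>-part of \<open>d\<close>; the real elements of
  \<open>\<int>[\<eta>] = \<int>[\<theta>\<^sub>1] + \<int>[\<theta>\<^sub>1]\<eta>\<close> are then those of \<open>\<int>[\<theta>\<^sub>1]\<close>.
  The Galois group consists of the maps \<open>\<theta>\<^sub>1 \<mapsto> \<theta>\<^sub>a\<close>, so it is the unit group modulo \<open>d\<close> divided by
  \<open>\<plusminus>1\<close>. If it is cyclic, then \<open>\<phi>(d)\<close> is at most twice the Carmichael function of \<open>d\<close>, which is
  Condition C; conversely a generator is built from primitive roots.\<close>

section \<open>Subrings of the complex numbers\<close>

hide_const (open) Divisibility.prime

locale complex_subring =
  fixes R :: "complex set"
  assumes one_closed [simp]: "1 \<in> R"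
    and diff_closed [simp]: "x \<in> R \<Longrightarrow> y \<in> R \<Longrightarrow> x - y \<in> R"
    and mult_closed [simp]: "x \<in> R \<Longrightarrow> y \<in> R \<Longrightarrow> x * y \<in> R"
begin

lemma zero_closed [simp]: "0 \<in> R"
  using diff_closed[of 1 1] by simp

lemma uminus_closed [simp]: "x \<in> R \<Longrightarrow> - x \<in> R"
  using diff_closed[of 0 x] by simp

lemma add_closed [simp]: "x \<in> R \<Longrightarrow> y \<in> R \<Longrightarrow> x + y \<in> R"
  using diff_closed[of x "- y"] by simp

lemma power_closed [simp]: "x \<in> R \<Longrightarrow> x ^ n \<in> R"
  by (induction n) auto

lemma sum_closed [simp]: "(\<And>i. i \<in> A \<Longrightarrow> f i \<in> R) \<Longrightarrow> sum f A \<in> R"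
  by (induction A rule: infinite_finite_induct) auto

lemma prod_closed [simp]: "(\<And>i. i \<in> A \<Longrightarrow> f i \<in> R) \<Longrightarrow> prod f A \<in> R"
  by (induction A rule: infinite_finite_induct) auto

lemma of_nat_closed [simp]: "of_nat n \<in> R"
  by (induction n) auto

lemma of_int_closed [simp]: "of_int k \<in> R"
  by (cases k rule: int_cases2) auto

text \<open>The quotient must lie in R: in the field of complex numbers every nonzero element
  divides everything.\<close>

definition dvdR :: "complex \<Rightarrow> complex \<Rightarrow> bool" (infix \<open>dvdR\<close> 50) where
  "a dvdR b \<longleftrightarrow> (\<exists>r\<in>R. b = a * r)"

lemma dvdR_0 [simp]: "a dvdR 0"
  unfolding dvdR_def by (rule bexI[of _ 0]) auto

lemma dvdR_refl [simp]: "a dvdR a"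
  unfolding dvdR_def by (rule bexI[of _ 1]) auto

lemma dvdR_add: "a dvdR x \<Longrightarrow> a dvdR y \<Longrightarrow> a dvdR (x + y)"
  unfolding dvdR_def by (metis add_closed distrib_left)

lemma dvdR_diff: "a dvdR x \<Longrightarrow> a dvdR y \<Longrightarrow> a dvdR (x - y)"
  unfolding dvdR_def by (metis diff_closed right_diff_distrib)

lemma dvdR_mult: "a dvdR x \<Longrightarrow> r \<in> R \<Longrightarrow> a dvdR (r * x)"
  unfolding dvdR_def by (metis mult_closed mult.left_commute)

lemma dvdR_mult2: "a dvdR x \<Longrightarrow> r \<in> R \<Longrightarrow> a dvdR (x * r)"
  using dvdR_mult[of a x r] by (simp add: mult.commute)

lemma dvdR_trans: "a dvdR b \<Longrightarrow> b dvdR c \<Longrightarrow> a dvdR c"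
  unfolding dvdR_def by (metis mult_closed mult.assoc)

lemma dvdR_sum: "(\<And>i. i \<in> A \<Longrightarrow> a dvdR f i) \<Longrightarrow> a dvdR sum f A"
  by (induction A rule: infinite_finite_induct) (auto intro: dvdR_add)

lemma dvdR_mult_mono: "a dvdR b \<Longrightarrow> c dvdR d \<Longrightarrow> a * c dvdR b * d"
proof -
  assume "a dvdR b" "c dvdR d"
  then obtain r s where "r \<in> R" "b = a * r" "s \<in> R" "d = c * s" by (auto simp: dvdR_def)
  then show ?thesis unfolding dvdR_def by (intro bexI[of _ "r * s"]) (auto simp: mult_ac)
qed

lemma dvdR_prod_mono: "(\<And>i. i \<in> A \<Longrightarrow> f i dvdR g i) \<Longrightarrow> prod f A dvdR prod g A"
  by (induction A rule: infinite_finite_induct) (auto intro: dvdR_mult_mono)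

lemma dvdR_power_diff:
  assumes "a dvdR (x - y)" "x \<in> R" "y \<in> R"
  shows "a dvdR (x ^ n - y ^ n)"
proof (induction n)
  case (Suc n)
  have "x ^ Suc n - y ^ Suc n = x * (x ^ n - y ^ n) + (x - y) * y ^ n"
    by (simp add: algebra_simps)
  also have "a dvdR \<dots>"
    using Suc assms by (intro dvdR_add dvdR_mult dvdR_mult2) auto
  finally show ?case .
qed auto

section \<open>Frobenius congruences modulo a prime\<close>

lemma of_nat_dvdR: "m dvd n \<Longrightarrow> of_nat m dvdR of_nat n"
  by (auto simp: dvdR_def elim!: dvdE)

lemma dvdR_frobenius_add:
  assumes "prime p" "x \<in> R" "y \<in> R"
  shows "of_nat p dvdR ((x + y) ^ p - x ^ p - y ^ p)"
proof -
  have p: "p > 0" "p \<noteq> 0" using assms prime_gt_0_nat by auto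
  define f where "f = (\<lambda>k. of_nat (p choose k) * x ^ k * y ^ (p - k))"
  have "{..p} = insert 0 (insert p {1..<p})" using p by auto
  then have "(x + y) ^ p = f 0 + f p + sum f {1..<p}"
    using p unfolding binomial_ring f_def by simp
  then have "(x + y) ^ p - x ^ p - y ^ p = sum f {1..<p}"
    by (simp add: f_def)
  also have "of_nat p dvdR \<dots>"
  proof (intro dvdR_sum)
    fix k assume k: "k \<in> {1..<p}"
    then have "p dvd (p choose k)"
      using assms by (intro dvd_choose_prime) auto
    then show "of_nat p dvdR f k"
      unfolding f_def using assms by (intro dvdR_mult2 of_nat_dvdR) auto
  qed
  finally show ?thesis .
qed

lemma dvdR_frobenius_nat:
  assumes "prime p"
  shows "of_nat p dvdR (of_nat n ^ p - of_nat n)"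
proof (induction n)
  case 0
  then show ?case using assms prime_gt_0_nat[of p] by (simp add: zero_power)
next
  case (Suc n)
  have "of_nat (Suc n) ^ p - of_nat (Suc n) =
      ((of_nat n + 1) ^ p - of_nat n ^ p - 1 ^ p) + (of_nat n ^ p - of_nat n :: complex)"
    by (simp add: add.commute[of 1])
  also have "of_nat p dvdR \<dots>"
    using dvdR_frobenius_add[OF assms, of "of_nat n" 1] Suc by (intro dvdR_add) auto
  finally show ?case .
qed

lemma dvdR_frobenius_int:
  assumes "prime p"
  shows "of_nat p dvdR (of_int k ^ p - of_int k)"
proof (cases k rule: int_cases2)
  case (nonneg n)
  then show ?thesis using dvdR_frobenius_nat[OF assms] by simp
next
  case (nonpos n)
  \<comment> \<open>Additivity applied to -n + n = 0 carries the congruence from n to -n, whatever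
    the parity of p.\<close>
  have "of_nat p dvdR (((- of_nat n + of_nat n) ^ p - (- of_nat n) ^ p - of_nat n ^ p)
     + (of_nat n ^ p - of_nat n))"
    using dvdR_frobenius_add[OF assms, of "- of_nat n" "of_nat n"] dvdR_frobenius_nat[OF assms]
    by (intro dvdR_add) auto
  moreover have "\<dots> = - 1 * (of_int k ^ p - of_int k)"
    using nonpos assms prime_gt_0_nat[of p] by (simp add: zero_power)
  ultimately show ?thesis
    by (metis dvdR_diff dvdR_0 diff_0 minus_mult_minus mult_1 mult_minus1)
qed

text \<open>If \<open>\<pi>\<close> divides \<open>\<gamma>\<close> up to an almost integral factor, then \<open>\<pi>\<close> divides a large power \<open>\<gamma>\<^sup>q\<close>
  in \<open>R\<close>, hence \<open>\<gamma>\<close> itself; this is iterated \<open>e\<close> times.\<close>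

lemma saturated_at_prime:
  assumes p: "prime p" and pi: "\<pi> \<in> R" and e: "e > 0" "\<pi> ^ e dvdR of_nat p" "of_nat p dvdR \<pi> ^ e"
    and frob: "\<And>N. \<exists>q\<ge>N. \<forall>x\<in>R. \<pi> dvdR (x ^ q - x)"
    and M: "M > 0" "\<And>j. of_nat M * \<alpha> ^ j \<in> R"
    and \<alpha>: "of_nat p * \<alpha> \<in> R"
  shows "\<alpha> \<in> R"
proof -
  define \<beta> where "\<beta> = of_nat p * \<alpha>"
  have p0: "of_nat p \<noteq> (0::complex)" using p prime_gt_0_nat[of p] by simp
  obtain u where u: "u \<in> R" "of_nat p = \<pi> ^ e * u" using e(2) by (auto simp: dvdR_def)
  obtain s where s: "s \<in> R" "\<pi> ^ e = of_nat p * s" using e(3) by (auto simp: dvdR_def)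
  have pi0: "\<pi> \<noteq> 0" using u p0 e(1) by auto
  \<comment> \<open>M is split into its p-part and a cofactor \<open>M'\<close> prime to p, which
    the Bezout relation \<open>ab\<close> inverts modulo p.\<close>
  have "M \<noteq> 0" "\<not> is_unit p" using M p by auto
  then obtain M' where M': "M = p ^ multiplicity p M * M'" "\<not> p dvd M'"
    using multiplicity_decompose'[of M p] by metis
  define v where "v = multiplicity p M"
  have "coprime M' p" using M'(2) p by (metis coprime_commute prime_imp_coprime)
  then have "coprime (int M') (int p)" by simp
  then obtain a b where "a * int M' + b * int p = 1"
    using bezout_int[of "int M'" "int p"] by (metis coprime_iff_gcd_eq_1)
  then have ab: "of_int a * of_nat M' + of_int b * of_nat p = (1::complex)"
    by (metis of_int_1 of_int_add of_int_mult of_int_of_nat_eq)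
  have pidvdp: "\<pi> dvdR of_nat p"
    using u pi e(1) unfolding dvdR_def
    by (intro bexI[of _ "\<pi> ^ (e - 1) * u"], cases e) auto
  \<comment> \<open>Divisibility of \<open>\<beta>\<close> by \<open>\<pi> ^ e\<close> suffices,
    since p divides \<open>\<pi> ^ e\<close> and can then be cancelled from
    \<open>\<beta>\<close>.\<close>
  have "i \<le> e \<Longrightarrow> \<pi> ^ i dvdR \<beta>" for i
  proof (induction i)
    case 0
    then show ?case using \<alpha> by (simp add: \<beta>_def dvdR_def)
  next
    case (Suc i)
    then obtain \<gamma> where \<gamma>: "\<gamma> \<in> R" "\<beta> = \<pi> ^ i * \<gamma>" by (auto simp: dvdR_def)
    define r where "r = u * \<pi> ^ (e - Suc i)"
    define \<alpha>' where "\<alpha>' = \<alpha> * r"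
    have r: "r \<in> R" using u pi by (simp add: r_def)
    have "\<pi> ^ i * \<gamma> = \<pi> ^ e * u * \<alpha>" using \<gamma>(2) u(2) by (simp add: \<beta>_def)
    also have "\<pi> ^ e = \<pi> ^ i * (\<pi> * \<pi> ^ (e - Suc i))"
      using Suc.prems by (simp flip: power_Suc power_add)
    finally have \<gamma>': "\<gamma> = \<pi> * \<alpha>'" using pi0 by (simp add: \<alpha>'_def r_def mult_ac)
    have M\<alpha>': "of_nat M * \<alpha>' ^ j \<in> R" for j
      using mult_closed[OF M(2)[of j] power_closed[OF r, of j]] by (simp add: \<alpha>'_def power_mult_distrib mult_ac)
    \<comment> \<open>In \<open>\<pi> ^ q\<close> the part \<open>\<pi> ^ (e * v)\<close> supplies
      \<open>p ^ v\<close>, the p-part of M, and one further factor \<open>\<pi>\<close> is left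
      over.\<close>
    obtain q where q: "q \<ge> e * v + 1" "\<forall>x\<in>R. \<pi> dvdR (x ^ q - x)" using frob by blast
    have "of_nat M' * \<gamma> ^ q = \<pi> * (s ^ v * \<pi> ^ (q - e * v - 1) * (of_nat M * \<alpha>' ^ q))"
    proof -
      have "\<pi> ^ q = \<pi> * (\<pi> ^ (e * v) * \<pi> ^ (q - e * v - 1))"
        using q(1) by (simp flip: power_Suc power_add)
      also have "\<pi> ^ (e * v) = of_nat p ^ v * s ^ v"
        by (simp add: power_mult s(2) power_mult_distrib)
      finally have piq: "\<pi> ^ q = \<pi> * (of_nat p ^ v * s ^ v * \<pi> ^ (q - e * v - 1))" .
      have Mc: "of_nat M = (of_nat p ^ v * of_nat M' :: complex)"
        using M'(1) by (metis of_nat_mult of_nat_power v_def)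
      have "of_nat M' * \<gamma> ^ q = of_nat M' * (\<pi> ^ q * \<alpha>' ^ q)"
        by (simp add: \<gamma>' power_mult_distrib)
      then show ?thesis unfolding piq Mc by (simp only: mult_ac)
    qed
    moreover have "s ^ v * \<pi> ^ (q - e * v - 1) * (of_nat M * \<alpha>' ^ q) \<in> R"
      using s pi M\<alpha>' by simp
    ultimately have 1: "\<pi> dvdR (of_nat M' * \<gamma> ^ q)" unfolding dvdR_def by blast
    \<comment> \<open>The Bezout relation writes \<open>\<gamma> ^ q\<close> as a sum of two
      multiples of \<open>\<pi>\<close>, and \<open>\<gamma> ^ q \<equiv> \<gamma>\<close> passes
      this on to \<open>\<gamma>\<close>.\<close>
    have "\<gamma> = (of_int a * (of_nat M' * \<gamma> ^ q) + of_int b * \<gamma> ^ q * of_nat p) - (\<gamma> ^ q - \<gamma>)"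
    proof -
      have "\<gamma> ^ q = \<gamma> ^ q * (of_int a * of_nat M' + of_int b * of_nat p)" using ab by simp
      then show ?thesis by (simp add: algebra_simps)
    qed
    also have "\<pi> dvdR \<dots>"
      using \<gamma>(1)
      by (intro dvdR_diff[OF dvdR_add[OF dvdR_mult[OF 1] dvdR_mult[OF pidvdp]] q(2)[rule_format]]) auto
    finally have "\<pi> dvdR \<gamma>" .
    then have "\<pi> ^ i * \<pi> dvdR \<pi> ^ i * \<gamma>" by (intro dvdR_mult_mono) auto
    then show ?case by (simp add: \<gamma>(2) mult.commute)
  qed
  from this[of e] obtain \<gamma> where "\<gamma> \<in> R" "\<beta> = \<pi> ^ e * \<gamma>" by (auto simp: dvdR_def)
  then have "\<alpha> = s * \<gamma>" using s p0 by (simp add: \<beta>_def)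
  then show ?thesis using s \<open>\<gamma> \<in> R\<close> by simp
qed

text \<open>Prime factors are removed from a denominator K of \<open>\<alpha>\<close> one at a time:
  for K = p L, saturation at p applies to L \<open>\<alpha>\<close>, since M still clears all its
  powers.\<close>

lemma integrally_closed_by_saturation:
  assumes sat: "\<And>p. prime p \<Longrightarrow> \<exists>\<pi>\<in>R. \<exists>e>0. \<pi> ^ e dvdR of_nat p \<and> of_nat p dvdR \<pi> ^ e \<and>
                 (\<forall>N. \<exists>q\<ge>N. \<forall>x\<in>R. \<pi> dvdR (x ^ q - x))"
    and M: "M > 0" "\<And>j. of_nat M * \<alpha> ^ j \<in> R"
  shows "\<alpha> \<in> R"
proof -
  have *: "of_nat K * \<alpha> \<in> R \<Longrightarrow> (\<And>j. of_nat M * \<alpha> ^ j \<in> R) \<Longrightarrow> K > 0 \<Longrightarrow> \<alpha> \<in> R" for K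
  proof (induction K arbitrary: \<alpha> rule: less_induct)
    case (less K)
    show ?case
    proof (cases "K = 1")
      case True
      then show ?thesis using less.prems by simp
    next
      case False
      then obtain p where p: "prime p" "p dvd K" using prime_factor_nat by blast
      then obtain L where L: "K = p * L" by blast
      have L': "L > 0" "L < K" using L less.prems(3) prime_gt_1_nat[OF p(1)] by auto
      obtain \<pi> e where pi: "\<pi> \<in> R" "e > 0" "\<pi> ^ e dvdR of_nat p" "of_nat p dvdR \<pi> ^ e"
        and frob: "\<forall>N. \<exists>q\<ge>N. \<forall>x\<in>R. \<pi> dvdR (x ^ q - x)"
        using sat[OF p(1)] by meson
      have 1: "of_nat M * (of_nat L * \<alpha>) ^ j \<in> R" for j
        using mult_closed[OF less.prems(2)[of j] power_closed[OF of_nat_closed[of L], of j]]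
        by (simp add: power_mult_distrib mult_ac)
      have "of_nat L * \<alpha> \<in> R"
        using less.prems(1) unfolding L of_nat_mult mult.assoc
        by (rule saturated_at_prime[OF p(1) pi spec[OF frob] M(1) 1])
      then show ?thesis by (rule less.IH[OF L'(2) _ less.prems(2) L'(1)])
    qed
  qed
  show ?thesis by (rule *[OF _ M(2,1)]) (use M(2)[of 1] in simp)
qed

text \<open>With n the degree of a monic equation, \<open>M ^ n\<close> clears the powers up to n
  directly; the equation reduces higher powers to lower ones with integer coefficients.\<close>

lemma algebraic_int_imp_almost_integral:
  assumes "algebraic_int \<alpha>" "M > 0" "of_nat M * \<alpha> \<in> R"
  shows "\<exists>N>0. \<forall>j. of_nat N * \<alpha> ^ j \<in> R"
proof -
  obtain P :: "int poly" where P: "poly (map_poly of_int P) \<alpha> = 0" "lead_coeff P = 1"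
    using assms(1) by (auto simp: algebraic_int_altdef_ipoly)
  define n where "n = Polynomial.degree P"
  have "of_nat (M ^ n) * \<alpha> ^ j \<in> R" for j
  proof (induction j rule: less_induct)
    case (less j)
    show ?case
    proof (cases "j \<le> n")
      case True
      have "of_nat (M ^ n) * \<alpha> ^ j = of_nat M ^ (n - j) * (of_nat M * \<alpha>) ^ j"
      proof -
        have "of_nat (M ^ n) = (of_nat M ^ (n - j) * of_nat M ^ j :: complex)"
          using True by (simp flip: power_add)
        then show ?thesis by (simp only: power_mult_distrib mult.assoc)
      qed
      then show ?thesis using assms by simp
    next
      case False
      have "0 = \<alpha> ^ (j - n) * (\<Sum>i\<le>n. of_int (coeff P i) * \<alpha> ^ i)"
        using P(1) by (simp add: poly_altdef n_def)
      also have "\<dots> = (\<Sum>i\<le>n. of_int (coeff P i) * \<alpha> ^ (i + (j - n)))"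
        by (simp add: sum_distrib_left power_add mult_ac)
      also have "{..n} = insert n {..<n}" by auto
      finally have "\<alpha> ^ j = - (\<Sum>i<n. of_int (coeff P i) * \<alpha> ^ (i + (j - n)))"
        using P(2) False by (simp add: n_def eq_neg_iff_add_eq_0)
      then have "of_nat (M ^ n) * \<alpha> ^ j = - (\<Sum>i<n. of_int (coeff P i) * (of_nat (M ^ n) * \<alpha> ^ (i + (j - n))))"
        by (simp add: sum_distrib_left mult_ac)
      also have "\<dots> \<in> R"
        by (intro uminus_closed sum_closed mult_closed less) (use False in auto)
      finally show ?thesis .
    qed
  qed
  then show ?thesis using assms(2) by (intro exI[of _ "M ^ n"]) auto
qed

end

section \<open>Rings generated by an algebraic integer\<close>

abbreviation ipoly :: "int poly \<Rightarrow> complex \<Rightarrow> complex" where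
  "ipoly h z \<equiv> poly (map_poly of_int h) z"

text \<open>The ring \<int>[z], given by evaluation so that each element comes with a polynomial
  that can also be evaluated at conjugates of z.\<close>

definition Zadj :: "complex \<Rightarrow> complex set" where
  "Zadj z = range (\<lambda>h. ipoly h z)"

lemma ipoly_in_Zadj [simp]: "ipoly h z \<in> Zadj z"
  by (auto simp: Zadj_def)

lemma ZadjE:
  assumes "x \<in> Zadj z"
  obtains h where "x = ipoly h z"
  using assms by (auto simp: Zadj_def)

lemma ipoly_pcompose: "ipoly (pcompose g h) z = ipoly g (ipoly h z)"
  by (induction g) (simp_all add: pcompose_pCons hom_distribs)

interpretation Zadj: complex_subring "Zadj z" for z
proof
  show "1 \<in> Zadj z" using ipoly_in_Zadj[of 1 z] by simp
next
  fix x y assume "x \<in> Zadj z" "y \<in> Zadj z"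
  then obtain g h where "x = ipoly g z" "y = ipoly h z" by (metis ZadjE)
  then show "x - y \<in> Zadj z" "x * y \<in> Zadj z"
    using ipoly_in_Zadj[of "g - h" z] ipoly_in_Zadj[of "g * h" z] by (simp_all add: hom_distribs)
qed

lemma gen_in_Zadj [simp]: "z \<in> Zadj z"
  using ipoly_in_Zadj[of "[:0, 1:]" z] by simp

lemma Zadj_mono:
  assumes "x \<in> Zadj z"
  shows "Zadj x \<subseteq> Zadj z"
proof
  fix y assume "y \<in> Zadj x"
  then obtain g h where "x = ipoly g z" "y = ipoly h x" using assms by (metis ZadjE)
  then have "y = ipoly (pcompose h g) z" by (simp add: ipoly_pcompose)
  then show "y \<in> Zadj z" by simp
qed

section \<open>Congruences between polynomial values\<close>

lemma (in complex_subring) ipoly_closed [simp]: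
  assumes "z \<in> R"
  shows "ipoly h z \<in> R"
  using assms by (induction h) (auto simp: hom_distribs)

lemma (in complex_subring) ipoly_dvdR_diff:
  assumes "a dvdR (x - y)" "x \<in> R" "y \<in> R"
  shows "a dvdR (ipoly h x - ipoly h y)"
proof (induction h)
  case (pCons c h)
  have "ipoly (pCons c h) x - ipoly (pCons c h) y = x * (ipoly h x - ipoly h y) + (x - y) * ipoly h y"
    by (simp add: hom_distribs algebra_simps)
  also have "a dvdR \<dots>"
    using assms pCons by (intro dvdR_add dvdR_mult dvdR_mult2 ipoly_closed) auto
  finally show ?case .
qed auto

text \<open>Induction along Horner's scheme: the p-th power is additive modulo p and fixes the
  integer coefficients.\<close>

lemma (in complex_subring) dvdR_frobenius_ipoly:
  assumes "prime p" "z \<in> R"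
  shows "of_nat p dvdR (ipoly h z ^ p - ipoly h (z ^ p))"
proof (induction h)
  case 0
  then show ?case using prime_gt_0_nat[OF assms(1)] by (simp add: zero_power)
next
  case (pCons c h)
  let ?x = "z * ipoly h z"
  have "ipoly (pCons c h) z ^ p - ipoly (pCons c h) (z ^ p) =
      ((of_int c + ?x) ^ p - of_int c ^ p - ?x ^ p) + (of_int c ^ p - of_int c)
      + z ^ p * (ipoly h z ^ p - ipoly h (z ^ p))"
    by (simp add: algebra_simps hom_distribs)
  also have "of_nat p dvdR \<dots>"
    using assms pCons
    by (intro dvdR_add dvdR_mult dvdR_frobenius_add dvdR_frobenius_int) auto
  finally show ?case .
qed

lemma (in complex_subring) dvdR_frobenius_ipoly_iterated:
  assumes "prime p" "z \<in> R"
  shows "of_nat p dvdR (ipoly h z ^ (p ^ k) - ipoly h (z ^ (p ^ k)))"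
proof (induction k)
  case (Suc k)
  have "ipoly h z ^ (p ^ Suc k) - ipoly h (z ^ (p ^ Suc k)) =
     ((ipoly h z ^ (p ^ k)) ^ p - (ipoly h (z ^ (p ^ k))) ^ p) +
     ((ipoly h (z ^ (p ^ k))) ^ p - ipoly h ((z ^ (p ^ k)) ^ p))"
    by (simp add: mult.commute flip: power_mult)
  also have "of_nat p dvdR \<dots>"
    using assms Suc
    by (intro dvdR_add dvdR_power_diff dvdR_frobenius_ipoly) auto
  finally show ?case .
qed auto

text \<open>An eigenvalue of an integer matrix is a root of the characteristic polynomial, which is
  monic with integer coefficients.\<close>

lemma algebraic_int_if_int_matrix:
  fixes A :: "nat \<Rightarrow> nat \<Rightarrow> int" and v :: "nat \<Rightarrow> complex"
  assumes A: "\<And>i. i < n \<Longrightarrow> (\<Sum>j<n. of_int (A i j) * v j) = x * v i"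
    and v: "i < n" "v i \<noteq> 0"
  shows "algebraic_int x"
proof -
  define M where "M = mat n n (\<lambda>(i, j). A i j)"
  define u where "u = vec n v"
  have M: "M \<in> carrier_mat n n" by (simp add: M_def)
  have "eigenvector (map_mat of_int M) u x"
    unfolding eigenvector_def
  proof (intro conjI)
    show "u \<noteq> 0\<^sub>v (dim_row (map_mat complex_of_int M))"
      using v by (auto simp: u_def M_def vec_eq_iff)
    show "map_mat of_int M *\<^sub>v u = x \<cdot>\<^sub>v u"
      using A by (intro eq_vecI) (auto simp: M_def u_def scalar_prod_def atLeast0LessThan)
  qed (auto simp: u_def M_def)
  then have "poly (char_poly (map_mat of_int M)) x = 0"
    using M eigenvalue_root_char_poly[of "map_mat of_int M" n x] by (auto simp: eigenvalue_def)
  then have "ipoly (char_poly M) x = 0"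
    by (simp add: of_int_hom.char_poly_hom[OF M])
  moreover have "lead_coeff (char_poly M) = 1"
    using degree_monic_char_poly[OF M] by simp
  ultimately show ?thesis by (auto simp: algebraic_int_altdef_ipoly)
qed

lemma algebraic_int_in_Zadj_root_of_unity:
  assumes "d > 0" "\<eta> ^ d = 1" "x \<in> Zadj \<eta>"
  shows "algebraic_int x"
proof -
  obtain h where h: "x = ipoly h \<eta>" using assms(3) by (rule ZadjE)
  define n where "n = Polynomial.degree h"
  \<comment> \<open>The matrix of multiplication by \<open>h(\<eta>)\<close> on the powers of
    \<open>\<eta>\<close>: the degree k term of h moves exponent i to \<open>(i + k) mod d\<close>,
    because \<open>\<eta> ^ d = 1\<close>.\<close>
  define A where "A = (\<lambda>i j. \<Sum>k | k \<le> n \<and> (i + k) mod d = j. coeff h k)"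
  have mod: "\<eta> ^ (m mod d) = \<eta> ^ m" for m
  proof -
    have "\<eta> ^ m = \<eta> ^ (d * (m div d) + m mod d)" by simp
    also have "\<dots> = \<eta> ^ (m mod d)" unfolding power_add power_mult using assms(2) by simp
    finally show ?thesis by simp
  qed
  show ?thesis
  proof (rule algebraic_int_if_int_matrix[of d A "\<lambda>j. \<eta> ^ j" x 0])
    fix i assume "i < d"
    have "(\<Sum>j<d. of_int (A i j) * \<eta> ^ j) =
        (\<Sum>j<d. \<Sum>k | k \<le> n \<and> (i + k) mod d = j. of_int (coeff h k) * \<eta> ^ ((i + k) mod d))"
      by (simp add: A_def sum_distrib_right)
    also have "\<dots> = (\<Sum>j\<in>{..<d}. \<Sum>k | k \<in> {..n} \<and> (i + k) mod d = j. of_int (coeff h k) * \<eta> ^ ((i + k) mod d))"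
      by simp
    also have "\<dots> = (\<Sum>k\<in>{..n}. of_int (coeff h k) * \<eta> ^ ((i + k) mod d))"
      using assms(1) by (intro sum.group) auto
    also have "\<dots> = x * \<eta> ^ i"
      by (simp add: mod h poly_altdef n_def power_add sum_distrib_left sum_distrib_right mult_ac)
    finally show "(\<Sum>j<d. of_int (A i j) * \<eta> ^ j) = x * \<eta> ^ i" .
  qed (use assms in auto)
qed

text \<open>Factors X are cancelled from an integer equation for x until the constant term is
  nonzero; this term is a multiple of x and does the work of a norm.\<close>

lemma (in complex_subring) dvdR_nonzero_int:
  assumes "x \<in> R" "x \<noteq> 0" "algebraic_int x"
  shows "\<exists>c. c \<noteq> 0 \<and> x dvdR of_int c"
proof -
  obtain P :: "int poly" where P: "ipoly P x = 0" "lead_coeff P = 1"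
    using assms(3) by (auto simp: algebraic_int_altdef_ipoly)
  then have "P \<noteq> 0" by auto
  from this P(1) show ?thesis
  proof (induction P)
    case (pCons c P)
    show ?case
    proof (cases "c = 0")
      case True
      then show ?thesis using pCons assms(2) by (simp add: hom_distribs)
    next
      case False
      have "of_int c = x * - ipoly P x"
        using pCons.prems by (simp add: hom_distribs add_eq_0_iff2)
      then show ?thesis
        using False assms(1) unfolding dvdR_def
        by (intro exI[of _ c] conjI bexI[of _ "- ipoly P x"]) auto
    qed
  qed auto
qed

section \<open>Roots of unity\<close>

text \<open>Otherwise the difference of the two monic polynomials would be nonzero of degree below
  \<open>card S\<close> and vanish on S.\<close>

lemma monic_eq_prod_roots:
  fixes p :: "'a :: idom poly"
  assumes "lead_coeff p = 1" "finite S" "card S = Polynomial.degree p" "\<And>s. s \<in> S \<Longrightarrow> poly p s = 0"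
  shows "p = (\<Prod>s\<in>S. [:- s, 1:])"
proof (rule ccontr)
  assume neq: "p \<noteq> (\<Prod>s\<in>S. [:- s, 1:])"
  define n where "n = Polynomial.degree p"
  define q where "q = p - (\<Prod>s\<in>S. [:- s, 1:])"
  have q0: "q \<noteq> 0" using neq by (simp add: q_def)
  have degP: "Polynomial.degree (\<Prod>s\<in>S. [:- s, 1:]) = n"
    using assms by (subst degree_prod_eq_sum_degree) (auto simp: n_def)
  have "lead_coeff (\<Prod>s\<in>S. [:- s, 1:]) = 1"
    by (simp add: lead_coeff_prod)
  then have "coeff q n = 0" using assms(1) degP by (simp add: q_def n_def)
  moreover have "Polynomial.degree q \<le> n"
    unfolding q_def using degP by (intro degree_diff_le) (auto simp: n_def)
  ultimately have "Polynomial.degree q \<noteq> n" "Polynomial.degree q \<le> n"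
    using q0 leading_coeff_0_iff[of q] by auto
  moreover have "S \<subseteq> {x. poly q x = 0}"
    using assms(2,4) by (auto simp: q_def poly_prod)
  then have "card S \<le> card {x. poly q x = 0}"
    by (intro card_mono poly_roots_finite q0)
  then have "card S \<le> Polynomial.degree q"
    using card_poly_roots_bound[OF q0] by simp
  ultimately show False using assms(3) by (simp add: n_def)
qed

lemma (in complex_subring) dvdR_minus_commute: "a dvdR (x - y) \<longleftrightarrow> a dvdR (y - x)"
  by (metis dvdR_0 dvdR_diff diff_0 minus_diff_eq)

locale unity_root =
  fixes \<eta> :: complex and d :: nat
  assumes d_pos: "d > 0" and power_eq_1_iff: "\<eta> ^ k = 1 \<longleftrightarrow> d dvd k"
begin

lemma power_d [simp]: "\<eta> ^ d = 1"
  by (simp add: power_eq_1_iff)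

lemma nonzero [simp]: "\<eta> \<noteq> 0"
  using power_d d_pos by (metis power_0_left zero_neq_one less_not_refl)

lemma power_mod: "\<eta> ^ (k mod d) = \<eta> ^ k"
proof -
  have "\<eta> ^ k = \<eta> ^ (d * (k div d) + k mod d)" by simp
  also have "\<dots> = \<eta> ^ (k mod d)" unfolding power_add power_mult by simp
  finally show ?thesis by simp
qed

lemma power_eq_iff: "\<eta> ^ a = \<eta> ^ b \<longleftrightarrow> [a = b] (mod d)"
proof -
  have *: "\<eta> ^ a = \<eta> ^ b \<longleftrightarrow> [a = b] (mod d)" if "a \<le> b" for a b
  proof -
    have "\<eta> ^ b = \<eta> ^ a * \<eta> ^ (b - a)" using that by (simp flip: power_add)
    then have "\<eta> ^ a = \<eta> ^ b \<longleftrightarrow> \<eta> ^ (b - a) = 1" by auto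
    also have "\<dots> \<longleftrightarrow> d dvd b - a" by (rule power_eq_1_iff)
    also have "\<dots> \<longleftrightarrow> [a = b] (mod d)" using that by (metis cong_altdef_nat cong_sym_eq)
    finally show ?thesis .
  qed
  show ?thesis using *[of a b] *[of b a] by (cases "a \<le> b") (auto simp: cong_sym_eq)
qed

lemma conjugate: "coprime a d \<Longrightarrow> unity_root (\<eta> ^ a) d"
  using d_pos by unfold_locales
    (simp_all add: power_eq_1_iff coprime_commute coprime_dvd_mult_right_iff flip: power_mult)

lemma prod_X_minus_powers: "monom 1 d - 1 = (\<Prod>i<d. [:- (\<eta> ^ i), 1:])"
proof -
  have inj: "inj_on (\<lambda>i. \<eta> ^ i) {..<d}"
    by (auto intro!: inj_onI simp: power_eq_iff cong_less_modulus_unique_nat)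
  have deg: "Polynomial.degree (monom 1 d - 1 :: complex poly) = d"
    using d_pos degree_add_eq_left[of "-1" "monom 1 d :: complex poly"] by (simp add: degree_monom_eq)
  have "monom 1 d - 1 = (\<Prod>s\<in>(\<lambda>i. \<eta> ^ i) ` {..<d}. [:- s, 1:])"
  proof (rule monic_eq_prod_roots)
    show "lead_coeff (monom 1 d - 1 :: complex poly) = 1"
      using d_pos unfolding deg by (simp add: coeff_1)
    fix s assume "s \<in> (\<lambda>i. \<eta> ^ i) ` {..<d}"
    then obtain i where "s = \<eta> ^ i" by auto
    then show "poly (monom 1 d - 1) s = 0"
      by (simp add: poly_monom power_eq_1_iff flip: power_mult)
  qed (simp_all add: card_image[OF inj] deg)
  then show ?thesis by (simp add: prod.reindex[OF inj])
qed

lemma algebraic_int_Zadj: "x \<in> Zadj \<eta> \<Longrightarrow> algebraic_int x"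
  using algebraic_int_in_Zadj_root_of_unity[OF d_pos power_d] .

text \<open>The quotient c / p is rational and an algebraic integer, hence an integer.\<close>

lemma of_nat_dvdR_of_int_iff:
  assumes "Zadj.dvdR \<eta> (of_nat p) (of_int c)" "p > 0"
  shows "int p dvd c"
proof -
  obtain r where r: "r \<in> Zadj \<eta>" "of_int c = of_nat p * r"
    using assms(1) by (auto simp: Zadj.dvdR_def)
  then have "r = of_int c / of_nat p" using assms(2) by (simp add: field_simps)
  then have "r \<in> \<rat>" by simp
  with algebraic_int_Zadj[OF r(1)] have "r \<in> \<int>" by (rule rational_algebraic_int_is_int)
  then obtain k where "r = of_int k" by (auto elim: Ints_cases)
  then have "of_int c = (of_int (int p * k) :: complex)" using r(2) by simp
  then have "c = int p * k" by (simp only: of_int_eq_iff)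
  then show ?thesis by simp
qed

text \<open>The prime p divides \<open>h(\<eta> ^ (k * p))\<close>. If that value is nonzero, it
  divides a nonzero integer, which p must then divide. Exponents matter only modulo d, so finitely
  many integers bound p.\<close>

lemma ipoly_root_large_prime_power:
  "\<exists>A. \<forall>p>A. prime p \<longrightarrow> (\<forall>k. ipoly h (\<eta> ^ k) = 0 \<longrightarrow> ipoly h (\<eta> ^ (k * p)) = 0)"
proof -
  have "\<exists>c. ipoly h (\<eta> ^ k) \<noteq> 0 \<longrightarrow> c \<noteq> 0 \<and> Zadj.dvdR \<eta> (ipoly h (\<eta> ^ k)) (of_int c)" for k
    using Zadj.dvdR_nonzero_int[of "ipoly h (\<eta> ^ k)" \<eta>] algebraic_int_Zadj[of "ipoly h (\<eta> ^ k)"]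
    by fastforce
  then obtain c where c: "\<And>k. ipoly h (\<eta> ^ k) \<noteq> 0 \<Longrightarrow> c k \<noteq> 0 \<and> Zadj.dvdR \<eta> (ipoly h (\<eta> ^ k)) (of_int (c k))"
    by metis
  define A where "A = (\<Sum>k<d. nat \<bar>c k\<bar>)"
  show ?thesis
  proof (intro exI[of _ A] allI impI)
    fix p k assume p: "p > A" "prime p" and k: "ipoly h (\<eta> ^ k) = 0"
    define j where "j = (k * p) mod d"
    have j: "j < d" using d_pos by (simp add: j_def)
    have eq: "\<eta> ^ (k * p) = \<eta> ^ j" by (simp add: j_def power_mod)
    show "ipoly h (\<eta> ^ (k * p)) = 0"
    proof (rule ccontr)
      assume "ipoly h (\<eta> ^ (k * p)) \<noteq> 0"
      then have cj: "c j \<noteq> 0" "Zadj.dvdR \<eta> (ipoly h (\<eta> ^ j)) (of_int (c j))"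
        using c[of j] eq by auto
      have "Zadj.dvdR \<eta> (of_nat p) (ipoly h (\<eta> ^ k) ^ p - ipoly h ((\<eta> ^ k) ^ p))"
        using p by (intro Zadj.dvdR_frobenius_ipoly) auto
      then have "Zadj.dvdR \<eta> (of_nat p) (0 - ipoly h (\<eta> ^ j))"
        using k p prime_gt_0_nat[of p] by (simp add: zero_power eq flip: power_mult)
      then have "Zadj.dvdR \<eta> (of_nat p) (ipoly h (\<eta> ^ j))"
        by (subst (asm) Zadj.dvdR_minus_commute) simp
      from Zadj.dvdR_trans[OF this cj(2)] have "int p dvd c j"
        using of_nat_dvdR_of_int_iff p prime_gt_0_nat by blast
      then have "p dvd nat \<bar>c j\<bar>" by (simp add: dvd_nat_abs_iff)
      then have "p \<le> nat \<bar>c j\<bar>" using cj(1) by (intro dvd_imp_le) auto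
      also have "\<dots> \<le> A" unfolding A_def using j by (intro member_le_sum) auto
      finally show False using p by simp
    qed
  qed
qed

text \<open>Landau's argument: only large primes are needed, since every residue class coprime
  to \<open>d\<close> contains a number all of whose prime factors are large.\<close>

lemma ipoly_root_conjugate:
  assumes "ipoly h \<eta> = 0" "coprime a d"
  shows "ipoly h (\<eta> ^ a) = 0"
proof -
  obtain A where A: "\<And>p k. p > A \<Longrightarrow> prime p \<Longrightarrow> ipoly h (\<eta> ^ k) = 0 \<Longrightarrow> ipoly h (\<eta> ^ (k * p)) = 0"
    using ipoly_root_large_prime_power[of h] by metis
  have large: "ipoly h (\<eta> ^ (k * m)) = 0"
    if "m > 0" "\<And>p. prime p \<Longrightarrow> p dvd m \<Longrightarrow> p > A" "ipoly h (\<eta> ^ k) = 0" for k m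
    using that
  proof (induction m arbitrary: k rule: less_induct)
    case (less m)
    show ?case
    proof (cases "m = 1")
      case True
      then show ?thesis using less.prems by simp
    next
      case False
      then obtain p where p: "prime p" "p dvd m" using prime_factor_nat by blast
      then obtain n where n: "m = p * n" by blast
      have "n > 0" "n < m" using n less.prems(1) prime_gt_1_nat[OF p(1)] by auto
      moreover have "ipoly h (\<eta> ^ (k * p)) = 0"
        using A less.prems(2,3) p by blast
      ultimately have "ipoly h (\<eta> ^ (k * p * n)) = 0"
        using less.prems(2) n by (intro less.IH[of n "k * p"]) auto
      then show ?thesis by (simp add: n mult.assoc)
    qed
  qed
  \<comment> \<open>A prime up to A that divides a does not divide \<open>d * B\<close>; any other
    prime up to A divides B but not a. So none of them divides \<open>a + d * B\<close>, which is
    congruent to a modulo d.\<close>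
  define B where "B = \<Prod>{q. prime q \<and> q \<le> A \<and> \<not> q dvd a}"
  define m where "m = a + d * B"
  have fin: "finite {q. prime q \<and> q \<le> A \<and> \<not> q dvd a}" by (rule finite_subset[of _ "{..A}"]) auto
  have "B > 0" unfolding B_def by (intro prod_pos) (auto intro: prime_gt_0_nat)
  then have m_pos: "m > 0" using d_pos by (simp add: m_def)
  have big: "p > A" if p: "prime p" "p dvd m" for p
  proof (rule ccontr)
    assume le: "\<not> p > A"
    show False
    proof (cases "p dvd a")
      case True
      then have "p dvd d * B" using p(2) by (simp add: m_def dvd_add_right_iff)
      then consider "p dvd d" | "p dvd B" using p(1) by (metis prime_dvd_multD)
      then show False
      proof cases
        case 1
        then have "p dvd 1" using assms(2) True by (metis coprime_common_divisor)
        then show False using p(1) by auto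
      next
        case 2
        then obtain q where q: "prime q" "\<not> q dvd a" "p dvd q"
          unfolding B_def using p(1) fin by (auto simp: prime_dvd_prod_iff)
        then have "p = q" using p(1) by (simp add: primes_dvd_imp_eq)
        then show False using q True by simp
      qed
    next
      case False
      then have "p dvd B" unfolding B_def using le p(1) fin by (intro dvd_prodI) auto
      then have "p dvd a" using p(2) by (simp add: m_def dvd_add_left_iff)
      then show False using False by simp
    qed
  qed
  have "ipoly h (\<eta> ^ (1 * m)) = 0"
    using assms(1) by (intro large m_pos) (auto intro: big)
  moreover have "\<eta> ^ m = \<eta> ^ a" unfolding power_eq_iff m_def by (simp add: cong_def)
  ultimately show ?thesis by simp
qed

text \<open>By Euler, \<open>q = p ^ (totient m * N)\<close> is 1 modulo m, so
  \<open>\<eta> ^ q \<equiv> \<eta>\<close> modulo \<open>\<pi>\<close>. Iterated Frobenius then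
  gives \<open>h(\<eta>) ^ q \<equiv> h(\<eta> ^ q) \<equiv> h(\<eta>)\<close>; the factor N makes q
  large.\<close>

lemma frobenius_trivial_mod:
  assumes p: "prime p" "coprime p m" "m > 0" and "\<pi> \<in> Zadj \<eta>"
    and dvd: "Zadj.dvdR \<eta> \<pi> (of_nat p)" "\<And>n. Zadj.dvdR \<eta> \<pi> (\<eta> ^ (m * n) - 1)"
  shows "\<exists>q\<ge>N. \<forall>x\<in>Zadj \<eta>. Zadj.dvdR \<eta> \<pi> (x ^ q - x)"
proof (intro exI[of _ "p ^ (totient m * N)"] conjI ballI)
  let ?q = "p ^ (totient m * N)"
  have "N \<le> 2 ^ N" by (simp add: order.strict_implies_order)
  also have "\<dots> \<le> p ^ N" using prime_ge_2_nat[OF p(1)] by (intro power_mono) auto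
  also have "N \<le> totient m * N" using p(3) by (simp add: Suc_le_eq)
  then have "p ^ N \<le> ?q" using prime_gt_0_nat[OF p(1)] by (intro power_increasing) auto
  finally show "N \<le> ?q" .
  have "[(p ^ totient m) ^ N = 1 ^ N] (mod m)"
    using p(2) by (intro cong_pow euler_theorem) (auto simp: coprime_commute)
  then have "[?q = 1] (mod m)" by (simp add: power_mult)
  moreover have "?q \<ge> 1" using prime_gt_0_nat[OF p(1)] by simp
  ultimately have "m dvd ?q - 1" by (simp add: cong_altdef_nat)
  then obtain n where "?q - 1 = m * n" by blast
  with \<open>?q \<ge> 1\<close> have n: "?q = Suc (m * n)" by simp
  have "\<eta> ^ ?q - \<eta> = \<eta> * (\<eta> ^ (m * n) - 1)" unfolding n by (simp add: algebra_simps)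
  moreover have "Zadj.dvdR \<eta> \<pi> (\<eta> * (\<eta> ^ (m * n) - 1))" using dvd(2) by (intro Zadj.dvdR_mult) auto
  ultimately have \<eta>: "Zadj.dvdR \<eta> \<pi> (\<eta> ^ ?q - \<eta>)" by simp
  fix x assume "x \<in> Zadj \<eta>"
  then obtain h where h: "x = ipoly h \<eta>" by (rule ZadjE)
  have "Zadj.dvdR \<eta> \<pi> ((ipoly h \<eta> ^ ?q - ipoly h (\<eta> ^ ?q)) + (ipoly h (\<eta> ^ ?q) - ipoly h \<eta>))"
  proof (rule Zadj.dvdR_add)
    show "Zadj.dvdR \<eta> \<pi> (ipoly h \<eta> ^ ?q - ipoly h (\<eta> ^ ?q))"
      using p(1) by (intro Zadj.dvdR_trans[OF dvd(1)] Zadj.dvdR_frobenius_ipoly_iterated) auto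
    show "Zadj.dvdR \<eta> \<pi> (ipoly h (\<eta> ^ ?q) - ipoly h \<eta>)"
      using \<eta> by (rule Zadj.ipoly_dvdR_diff) auto
  qed
  then show "Zadj.dvdR \<eta> \<pi> (x ^ ?q - x)" by (simp add: h)
qed

end

text \<open>The value at 1 of the cyclotomic polynomial of a prime power.\<close>

lemma prod_one_minus_prime_power_roots:
  assumes "unity_root \<zeta> (p ^ Suc a)" "prime p"
  shows "(\<Prod>i | i < p ^ Suc a \<and> \<not> p dvd i. 1 - \<zeta> ^ i) = of_nat p"
proof -
  interpret z: unity_root \<zeta> "p ^ Suc a" by fact
  have p0: "p > 0" using assms(2) prime_gt_0_nat by blast
  interpret zp: unity_root "\<zeta> ^ p" "p ^ a"
    using p0 by unfold_locales (auto simp: z.power_eq_1_iff simp flip: power_mult)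
  let ?I = "{i. i < p ^ Suc a \<and> \<not> p dvd i}"
  let ?f = "\<lambda>i. [:- (\<zeta> ^ i), 1:]"
  \<comment> \<open>With \<open>Y = X ^ (p ^ a)\<close>, the product over exponents prime to p
    becomes \<open>(Y ^ p - 1) / (Y - 1) = 1 + Y + ... + Y ^ (p - 1)\<close>, whose value at X = 1
    is p.\<close>
  define Y where "Y = (monom 1 (p ^ a) :: complex poly)"
  have Yp: "Y ^ p = monom 1 (p ^ Suc a)" by (simp add: Y_def monom_power mult.commute)
  have *: "Y - 1 = (\<Prod>i<p ^ a. ?f (p * i))"
    using zp.prod_X_minus_powers by (simp add: Y_def power_mult)
  have "{..<p ^ Suc a} = ?I \<union> (\<lambda>i. p * i) ` {..<p ^ a}"
    using p0 by (auto simp: image_iff elim!: dvdE)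
  moreover have "prod ?f (?I \<union> (\<lambda>i. p * i) ` {..<p ^ a}) = prod ?f ?I * prod ?f ((\<lambda>i. p * i) ` {..<p ^ a})"
    by (rule prod.union_disjoint) auto
  ultimately have "(\<Prod>i<p ^ Suc a. ?f i) = (\<Prod>i\<in>?I. ?f i) * (\<Prod>i\<in>(\<lambda>i. p * i) ` {..<p ^ a}. ?f i)"
    by (simp only:)
  also have "(\<Prod>i\<in>(\<lambda>i. p * i) ` {..<p ^ a}. ?f i) = Y - 1"
    unfolding * using p0 by (subst prod.reindex) (auto intro: inj_onI)
  finally have "Y ^ p - 1 = (\<Prod>i\<in>?I. ?f i) * (Y - 1)"
    unfolding Yp z.prod_X_minus_powers .
  also have "Y ^ p - 1 = (\<Sum>i<p. Y ^ i) * (Y - 1)" by (simp add: power_diff_1_eq mult.commute)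
  finally have "(\<Sum>i<p. Y ^ i) = (\<Prod>i\<in>?I. ?f i)"
    using p0 by (auto simp: Y_def monom_eq_1_iff)
  then have "poly (\<Sum>i<p. Y ^ i) 1 = poly (\<Prod>i\<in>?I. ?f i) 1" by simp
  then show ?thesis by (simp add: poly_sum poly_prod Y_def poly_monom)
qed

section \<open>Uniformizers and integral closedness of \<int>[\<eta>]\<close>

context unity_root
begin

text \<open>When p divides d, the factors \<open>1 - \<zeta> ^ i\<close> with i prime to p are all
  associated to \<open>\<pi> = 1 - \<zeta>\<close> and their product is p, so e is the number of
  these factors.\<close>

lemma prime_uniformizer:
  assumes p: "prime p"
  shows "\<exists>\<pi>\<in>Zadj \<eta>. \<exists>e>0. Zadj.dvdR \<eta> (\<pi> ^ e) (of_nat p) \<and> Zadj.dvdR \<eta> (of_nat p) (\<pi> ^ e) \<and>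
           (\<forall>N. \<exists>q\<ge>N. \<forall>x\<in>Zadj \<eta>. Zadj.dvdR \<eta> \<pi> (x ^ q - x))"
proof (cases "p dvd d")
  case False
  then have "coprime p d" using p by (simp add: prime_imp_coprime)
  then have "\<exists>q\<ge>N. \<forall>x\<in>Zadj \<eta>. Zadj.dvdR \<eta> (of_nat p) (x ^ q - x)" for N
    using d_pos by (intro frobenius_trivial_mod[OF p, of d]) (auto simp: power_mult)
  then show ?thesis by (intro bexI[of _ "of_nat p"] exI[of _ 1]) auto
next
  case True
  have "d \<noteq> 0" "\<not> is_unit p" using d_pos p by auto
  then obtain m where m: "d = p ^ multiplicity p d * m" "\<not> p dvd m"
    using multiplicity_decompose'[of d p] by metis
  have "multiplicity p d > 0" using True d_pos p by (simp add: prime_multiplicity_gt_zero_iff)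
  then obtain a where a: "d = p ^ Suc a * m" using m(1) by (metis gr0_implies_Suc)
  have m_pos: "m > 0" using a d_pos by (auto intro: Nat.gr0I)
  have cop: "coprime p m" using m(2) p by (simp add: prime_imp_coprime)
  define \<zeta> where "\<zeta> = \<eta> ^ m"
  define \<pi> where "\<pi> = 1 - \<zeta>"
  define I where "I = {i. i < p ^ Suc a \<and> \<not> p dvd i}"
  have ur: "unity_root \<zeta> (p ^ Suc a)"
    using prime_gt_0_nat[OF p] m_pos
    by unfold_locales (auto simp: \<zeta>_def power_eq_1_iff a mult.commute simp flip: power_mult)
  interpret z: unity_root \<zeta> "p ^ Suc a" by (fact ur)
  have finI: "finite I" by (simp add: I_def)
  have "1 < p ^ Suc a" using prime_gt_1_nat[OF p] by (intro one_less_power) auto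
  then have "1 \<in> I" using prime_gt_1_nat[OF p] by (auto simp: I_def)
  then have e: "card I > 0" using finI by (auto simp: card_gt_0_iff)
  have \<zeta>R: "\<zeta> \<in> Zadj \<eta>" and piR: "\<pi> \<in> Zadj \<eta>" by (auto simp: \<zeta>_def \<pi>_def)
  have pi_dvd: "Zadj.dvdR \<eta> \<pi> (1 - \<zeta> ^ i)" for i
    using Zadj.dvdR_power_diff[of \<eta> \<pi> 1 \<zeta> i] \<zeta>R by (simp add: \<pi>_def)
  have dvd_pi: "Zadj.dvdR \<eta> (1 - \<zeta> ^ i) \<pi>" if "i \<in> I" for i
  proof -
    have "coprime i (p ^ Suc a)" using that prime_imp_coprime[OF p, of i] by (auto simp: I_def coprime_commute)
    \<comment> \<open>Since j inverts i modulo the order of \<open>\<zeta>\<close>,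
      \<open>1 - \<zeta> = 1 - (\<zeta> ^ i) ^ j\<close> is a multiple of
      \<open>1 - \<zeta> ^ i\<close>.\<close>
    from cong_solve_coprime_nat[OF this] obtain j where "[i * j = 1] (mod (p ^ Suc a))" by auto
    then have "\<zeta> ^ (i * j) = \<zeta> ^ 1" by (simp only: z.power_eq_iff)
    then show ?thesis
      using Zadj.dvdR_power_diff[of \<eta> "1 - \<zeta> ^ i" 1 "\<zeta> ^ i" j] \<zeta>R by (simp add: \<pi>_def power_mult)
  qed
  have prod: "(\<Prod>i\<in>I. 1 - \<zeta> ^ i) = of_nat p"
    unfolding I_def by (rule prod_one_minus_prime_power_roots[OF ur p])
  have 1: "Zadj.dvdR \<eta> (\<pi> ^ card I) (of_nat p)"
    using Zadj.dvdR_prod_mono[of I \<eta> "\<lambda>_. \<pi>" "\<lambda>i. 1 - \<zeta> ^ i"] pi_dvd prod by simp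
  have 2: "Zadj.dvdR \<eta> (of_nat p) (\<pi> ^ card I)"
    using Zadj.dvdR_prod_mono[of I \<eta> "\<lambda>i. 1 - \<zeta> ^ i" "\<lambda>_. \<pi>"] dvd_pi prod by simp
  have "Zadj.dvdR \<eta> (\<pi> ^ 1) (\<pi> ^ card I)"
    using e piR unfolding Zadj.dvdR_def by (intro bexI[of _ "\<pi> ^ (card I - 1)"]) (auto simp flip: power_Suc)
  then have 3: "Zadj.dvdR \<eta> \<pi> (of_nat p)" using 1 Zadj.dvdR_trans by simp
  \<comment> \<open>Modulo \<open>\<pi>\<close> the element \<open>\<zeta> = \<eta> ^ m\<close>
    becomes 1, so \<open>\<eta>\<close> behaves like an m-th root of unity with m prime to
    p.\<close>
  have "Zadj.dvdR \<eta> \<pi> (\<eta> ^ (m * n) - 1)" for n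
    using pi_dvd[of n] by (subst Zadj.dvdR_minus_commute) (simp add: \<zeta>_def power_mult)
  then have "\<exists>q\<ge>N. \<forall>x\<in>Zadj \<eta>. Zadj.dvdR \<eta> \<pi> (x ^ q - x)" for N
    by (intro frobenius_trivial_mod[OF p cop m_pos piR 3])
  with 1 2 e piR show ?thesis by blast
qed

text \<open>The multiple \<open>of_nat M * \<alpha>\<close> in \<int>[\<eta>] expresses that
  \<open>\<alpha>\<close> lies in the fraction field.\<close>

theorem Zadj_integrally_closed:
  assumes "algebraic_int \<alpha>" "M > 0" "of_nat M * \<alpha> \<in> Zadj \<eta>"
  shows "\<alpha> \<in> Zadj \<eta>"
proof -
  obtain N where N: "N > 0" "\<And>j. of_nat N * \<alpha> ^ j \<in> Zadj \<eta>"
    using Zadj.algebraic_int_imp_almost_integral[OF assms] by metis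
  show ?thesis by (rule Zadj.integrally_closed_by_saturation[OF prime_uniformizer N])
qed

end

section \<open>Residue classes up to sign\<close>

text \<open>Cyclicity of the units modulo d up to sign; \<open>d dvd a + g ^ k\<close> says that a
  is minus a power of g without subtracting naturals.\<close>

definition cyclic_mod_pm1 :: "nat \<Rightarrow> bool" where
  "cyclic_mod_pm1 d \<longleftrightarrow> (\<exists>g. coprime g d \<and> (\<forall>a. coprime a d \<longrightarrow> (\<exists>k. [a = g ^ k] (mod d) \<or> d dvd a + g ^ k)))"

text \<open>Modulo d, g has at most \<open>Carmichael d\<close> different powers; these and their
  negatives cover all units.\<close>

lemma totient_le_if_cyclic_mod_pm1:
  assumes "cyclic_mod_pm1 d" "d > 1"
  shows "totient d \<le> 2 * Carmichael d"
proof -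
  obtain g where g: "coprime g d"
    "\<And>a. coprime a d \<Longrightarrow> \<exists>k. [a = g ^ k] (mod d) \<or> d dvd a + g ^ k"
    using assms(1) unfolding cyclic_mod_pm1_def by blast
  define E where "E = Carmichael d"
  have E: "E > 0" by (simp add: E_def)
  have gE: "[g ^ E = 1] (mod d)"
    unfolding E_def using assms(2) g(1) by (intro power_Carmichael_eq_1) (auto simp: coprime_commute)
  have red: "[g ^ k = g ^ (k mod E)] (mod d)" for k
  proof -
    have "g ^ k = (g ^ E) ^ (k div E) * g ^ (k mod E)"
      by (simp flip: power_mult power_add)
    also have "[\<dots> = 1 ^ (k div E) * g ^ (k mod E)] (mod d)"
      using gE by (intro cong_mult cong_pow) auto
    finally show ?thesis by simp
  qed
  have "totatives d \<subseteq> (\<lambda>k. g ^ k mod d) ` {..<E} \<union> (\<lambda>k. d - g ^ k mod d) ` {..<E}"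
  proof
    fix a assume a: "a \<in> totatives d"
    then have "a \<noteq> d" using assms(2) by (auto simp: totatives_def)
    then have a': "0 < a" "a < d" "coprime a d" using a by (auto simp: totatives_def)
    then obtain k where "[a = g ^ k] (mod d) \<or> d dvd a + g ^ k" using g(2) by blast
    then show "a \<in> (\<lambda>k. g ^ k mod d) ` {..<E} \<union> (\<lambda>k. d - g ^ k mod d) ` {..<E}"
    proof
      assume "[a = g ^ k] (mod d)"
      then have "[a = g ^ (k mod E)] (mod d)" using red cong_trans by blast
      then have "a = g ^ (k mod E) mod d" using a' by (simp add: cong_def)
      then show ?thesis using E by auto
    next
      assume dvd: "d dvd a + g ^ k"
      define r where "r = g ^ (k mod E) mod d"
      have r: "r < d" using assms(2) by (simp add: r_def)
      have "[a + g ^ k = a + r] (mod d)"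
        using red[of k] by (intro cong_add) (auto simp: r_def cong_def)
      then have "d dvd a + r" using dvd cong_dvd_iff by blast
      then obtain c where c: "a + r = d * c" by blast
      have "a + r < d * 2" "a + r > 0" using a' r by auto
      then have "c = 1" unfolding c by (auto simp: less_2_cases_iff)
      then have "a = d - r" using c by simp
      then show ?thesis using E by (auto simp: r_def)
    qed
  qed
  then have "card (totatives d) \<le> card ((\<lambda>k. g ^ k mod d) ` {..<E} \<union> (\<lambda>k. d - g ^ k mod d) ` {..<E})"
    by (intro card_mono) auto
  also have "\<dots> \<le> card ((\<lambda>k. g ^ k mod d) ` {..<E}) + card ((\<lambda>k. d - g ^ k mod d) ` {..<E})"
    by (rule card_Un_le)
  also have "\<dots> \<le> E + E"
    by (intro add_mono order.trans[OF card_image_le]) auto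
  finally show ?thesis by (simp add: totient_def E_def)
qed

lemma two_lcm_le_mult:
  fixes a b :: nat
  assumes "even a" "even b"
  shows "2 * lcm a b \<le> a * b"
proof (cases "a = 0 \<or> b = 0")
  case False
  have "2 dvd gcd a b" using assms by simp
  then have "2 \<le> gcd a b" using False by (intro dvd_imp_le) auto
  then have "2 * lcm a b \<le> gcd a b * lcm a b" by (rule mult_le_mono1)
  then show ?thesis by simp
qed auto

text \<open>The bound \<open>totient d \<le> 2 * Carmichael d\<close> limits the coprime factors:
  two prime powers must have totients with gcd 2, and three nontrivial factors would give
  \<open>4 * Carmichael d \<le> totient d\<close>.\<close>

lemma condition_C_if_cyclic_mod_pm1:
  assumes "cyclic_mod_pm1 d" "d > 1" "odd d"
  shows "condition_C d"
proof -
  have le: "totient d \<le> 2 * Carmichael d" by (rule totient_le_if_cyclic_mod_pm1[OF assms(1,2)])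
  have split: "\<exists>p a m. prime p \<and> odd p \<and> a > 0 \<and> n = p ^ a * m \<and> coprime p m \<and> odd m \<and> m > 0"
    if n: "n > 1" "odd n" for n :: nat
  proof -
    obtain p where p: "prime p" "p dvd n" using n(1) prime_factor_nat[of n] by auto
    have "n \<noteq> 0" "\<not> is_unit p" using n p by auto
    then obtain m where m: "n = p ^ multiplicity p n * m" "\<not> p dvd m"
      using multiplicity_decompose'[of n p] by metis
    have "multiplicity p n > 0" using p n by (simp add: prime_multiplicity_gt_zero_iff)
    moreover have "odd p" using p n by auto
    moreover have "odd m" using m(1) n(2) by (metis even_mult_iff)
    moreover have "coprime p m" using p m by (simp add: prime_imp_coprime)
    ultimately show ?thesis using p m by (metis even_zero gr0I)
  qed
  have even: "even (totient n)" if "n > 1" "odd n" for n :: nat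
    using that by (intro totient_even) (cases "n = 2"; auto)
  obtain p a m where p: "prime p" "odd p" "a > 0" "d = p ^ a * m" "coprime p m" "odd m" "m > 0"
    using split[of d] assms by blast
  have pa: "p ^ a > 1" "odd (p ^ a)" using one_less_power[OF prime_gt_1_nat[OF p(1)] p(3)] p(2) by simp_all
  have Cp: "Carmichael (p ^ a) dvd totient (p ^ a)" by (rule Carmichael_dvd_totient)
  show ?thesis
  proof (cases "m = 1")
    case True
    then show ?thesis using p assms(2) unfolding condition_C_def by auto
  next
    case False
    then have "m > 1" using p by simp
    then obtain q b r where q: "prime q" "odd q" "b > 0" "m = q ^ b * r" "coprime q r" "odd r" "r > 0"
      using split[of m] p by blast
    have qb: "q ^ b > 1" "odd (q ^ b)" using one_less_power[OF prime_gt_1_nat[OF q(1)] q(3)] q(2) by simp_all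
    have cop: "coprime (p ^ a) m" "coprime (q ^ b) r" using p q by auto
    have pq: "p \<noteq> q" using p q by auto
    have tot: "totient d = totient (p ^ a) * (totient (q ^ b) * totient r)"
      using p(4) q(4) cop by (simp add: totient_mult_coprime)
    have Car: "Carmichael d = lcm (Carmichael (p ^ a)) (lcm (Carmichael (q ^ b)) (Carmichael r))"
      using p(4) q(4) cop by (simp add: Carmichael_mult_coprime)
    have pos: "totient (p ^ a) > 0" "totient (q ^ b) > 0" "totient r > 0"
      using prime_gt_0_nat[OF p(1)] prime_gt_0_nat[OF q(1)] q(7) by simp_all
    show ?thesis
    proof (cases "r = 1")
      case True
      let ?x = "totient (p ^ a)" and ?y = "totient (q ^ b)"
      have "Carmichael d dvd lcm ?x ?y"
        unfolding Car using True by (intro lcm_mono) (auto intro: Carmichael_dvd_totient)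
      then have "Carmichael d \<le> lcm ?x ?y" using pos by (intro dvd_imp_le lcm_pos_nat) auto
      then have "?x * ?y \<le> 2 * lcm ?x ?y" using le tot True by simp
      then have "gcd ?x ?y * lcm ?x ?y \<le> 2 * lcm ?x ?y" by simp
      moreover have "lcm ?x ?y > 0" using pos by (intro lcm_pos_nat) auto
      ultimately have "gcd ?x ?y \<le> 2" by (rule mult_right_le_imp_le)
      moreover have "2 dvd gcd ?x ?y" using even pa qb by simp
      then have "2 \<le> gcd ?x ?y" using pos by (intro dvd_imp_le) auto
      ultimately have "gcd ?x ?y = 2" by simp
      moreover have "d = p ^ a * q ^ b" using p q True by simp
      ultimately have "\<exists>p q a b. prime p \<and> odd p \<and> prime q \<and> odd q \<and> p \<noteq> q \<and> a > 0 \<and> b > 0 \<and>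
          gcd (totient (p ^ a)) (totient (q ^ b)) = 2 \<and> (d = p ^ a * q ^ b \<or> d = 2 * p ^ a * q ^ b)"
        using p(1-3) q(1-3) pq by blast
      moreover have "d \<ge> 2" using assms(2) by simp
      ultimately show ?thesis unfolding condition_C_def by blast
    next
      case False
      let ?x = "totient (p ^ a)" and ?y = "totient (q ^ b)" and ?z = "totient r"
      have ev: "even ?x" "even ?y" "even ?z" using even pa qb q False by auto
      have "Carmichael d dvd lcm ?x (lcm ?y ?z)"
        unfolding Car by (intro lcm_mono Carmichael_dvd_totient)
      then have 1: "Carmichael d \<le> lcm ?x (lcm ?y ?z)" using pos by (intro dvd_imp_le lcm_pos_nat) auto
      have "even (lcm ?y ?z)" using ev by (meson dvd_lcm1 dvd_trans)
      then have 2: "2 * lcm ?x (lcm ?y ?z) \<le> ?x * lcm ?y ?z" using ev by (intro two_lcm_le_mult)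
      have 3: "?x * (2 * lcm ?y ?z) \<le> ?x * (?y * ?z)"
        using ev by (intro mult_le_mono2 two_lcm_le_mult)
      have "?x * (2 * lcm ?y ?z) = 2 * (?x * lcm ?y ?z)" by simp
      with 1 2 3 have "4 * Carmichael d \<le> totient d" unfolding tot by linarith
      moreover have "totient d > 0" using assms(2) by simp
      ultimately show ?thesis using le by linarith
    qed
  qed
qed

section \<open>Primitive roots and sufficiency of Condition C\<close>

lemma primroot_generates:
  assumes "residue_primroot n x" "n > 1" "coprime a n"
  obtains i where "[a = x ^ i] (mod n)"
proof -
  have "a mod n \<in> totatives n"
  proof -
    have "coprime (a mod n) n" using assms by simp
    moreover have "a mod n \<noteq> 0"
    proof
      assume "a mod n = 0"
      with \<open>coprime (a mod n) n\<close> show False using assms(2) by simp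
    qed
    ultimately show ?thesis using assms(2) by (auto simp: totatives_def less_imp_le)
  qed
  then have "a mod n \<in> (\<lambda>i. x ^ i mod n) ` {..<totient n}"
    using residue_primroot_is_generator[OF assms(2,1)] by (simp add: bij_betw_def)
  then show ?thesis using that by (auto simp: cong_def)
qed

lemma primroot_minus_1:
  assumes "residue_primroot n x" "n > 1"
  obtains e where "n dvd x ^ e + 1"
proof -
  have "coprime (n - 1) n" using coprime_diff_one_left_nat[of n] assms(2) by simp
  then obtain e where "[n - 1 = x ^ e] (mod n)" using primroot_generates[OF assms] by blast
  then have "[n - 1 + 1 = x ^ e + 1] (mod n)" by (intro cong_add) auto
  then have "[x ^ e + 1 = 0] (mod n)" using assms(2) by (simp add: cong_def)
  then show ?thesis using that by (simp add: cong_0_iff)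
qed

lemma cong_minus_1_mult:
  assumes "(n::nat) dvd x ^ e + 1"
  shows "n dvd x ^ i + x ^ (i + e)"
proof -
  have "n dvd x ^ i * (x ^ e + 1)" using assms by (rule dvd_mult)
  then show ?thesis by (simp add: power_add algebra_simps)
qed

lemma primroot_cong_iff:
  assumes "residue_primroot n x"
  shows "[x ^ i = x ^ j] (mod n) \<longleftrightarrow> [i = j] (mod totient n)"
  using assms order_divides_expdiff[of n x i j] by (simp add: residue_primroot_def)

lemma dvd_add_cong:
  assumes "(n::nat) dvd a + b" "[a = a'] (mod n)" "[b = b'] (mod n)"
  shows "n dvd a' + b'"
  using assms cong_add[OF assms(2,3)] cong_dvd_iff by blast

text \<open>If \<open>\<phi>(A)/2\<close> is odd, then \<open>-1\<close> is an odd power of a primitive root \<open>x\<close> modulo \<open>A\<close>; hence up to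
  sign every unit is a square modulo \<open>A\<close>, and \<open>x\<^sup>2\<close> has order coprime to \<open>\<phi>(B)\<close>.\<close>

lemma cyclic_mod_pm1_mult:
  assumes A: "residue_primroot A x" "A > 2" and B: "residue_primroot B y" "B > 2"
    and cop: "coprime A B" and h: "totient A = 2 * h" "odd h" "coprime h (totient B)"
  shows "cyclic_mod_pm1 (A * B)"
proof -
  obtain g where g: "[g = x ^ 2] (mod A)" "[g = y] (mod B)"
    using binary_chinese_remainder_nat[OF cop, of "x ^ 2" y] by blast
  have xy: "coprime x A" "coprime y B" using A(1) B(1) by (auto simp: residue_primroot_def coprime_commute)
  have "coprime g A" "coprime g B"
    using g xy by (auto intro!: cong_imp_coprime[of _ g] simp: cong_sym_eq)
  then have gcop: "coprime g (A * B)" by simp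
  have gA: "[g ^ k = x ^ (2 * k)] (mod A)" for k using cong_pow[OF g(1), of k] by (simp add: power_mult)
  have gB: "[g ^ k = y ^ k] (mod B)" for k using cong_pow[OF g(2), of k] .
  \<comment> \<open>Modulo A the requirement is that \<open>2 * k\<close> be i modulo
    \<open>2 * h\<close>, that is, k is half of i modulo h. As h is coprime to
    \<open>totient B\<close>, this is compatible with any requirement modulo
    \<open>totient B\<close>.\<close>
  have solve: "\<exists>k. [g ^ k = x ^ i] (mod A) \<and> [g ^ k = y ^ j] (mod B)" if i: "even i" for i j
  proof -
    obtain i' where i': "i = 2 * i'" using i by (auto elim: evenE)
    obtain k where k: "[k = i'] (mod h)" "[k = j] (mod totient B)"
      using binary_chinese_remainder_nat[OF h(3), of i' j] by blast
    have "[2 * k = i] (mod totient A)"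
      unfolding i' h(1) using k(1) by (simp add: cong_def mult_mod_right[symmetric])
    then have "[x ^ (2 * k) = x ^ i] (mod A)" using primroot_cong_iff[OF A(1)] by blast
    moreover have "[y ^ k = y ^ j] (mod B)" using k(2) primroot_cong_iff[OF B(1)] by blast
    ultimately show ?thesis using gA gB cong_trans by blast
  qed
  obtain e where e: "A dvd x ^ e + 1" using primroot_minus_1[OF A(1)] A(2) by auto
  obtain e' where e': "B dvd y ^ e' + 1" using primroot_minus_1[OF B(1)] B(2) by auto
  \<comment> \<open>From \<open>x ^ (2 * e) \<equiv> 1\<close> it follows that h divides e. As h is
    odd, an even e would be a multiple of \<open>totient A = 2 * h\<close>, and \<open>x ^ e\<close>
    would be both 1 and -1 modulo A > 2.\<close>
  have "odd e"
  proof
    assume "even e"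
    have "x ^ (2 * e) - 1 = (x ^ e + 1) * (x ^ e - 1)"
      by (simp add: algebra_simps power_mult power2_eq_square power_mult_distrib)
    then have "A dvd x ^ (2 * e) - 1" using dvd_mult2[OF e, of "x ^ e - 1"] by (simp only:)
    then have "[x ^ (2 * e) = x ^ 0] (mod A)"
      by (cases "x = 0") (use xy A(2) in \<open>auto simp: cong_altdef_nat\<close>)
    then have "[2 * e = 0] (mod 2 * h)" using primroot_cong_iff[OF A(1)] h(1) by metis
    then have "h dvd e" by (simp add: cong_0_iff)
    then have "2 * h dvd e" using \<open>even e\<close> h(2) by (intro divides_mult) auto
    then have "[e = 0] (mod totient A)" using h(1) by (simp add: cong_0_iff)
    then have "[x ^ e = x ^ 0] (mod A)" using primroot_cong_iff[OF A(1)] by blast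
    then have "[x ^ e + 1 = 1 + 1] (mod A)" by (intro cong_add) auto
    then have "A dvd 2" using e cong_dvd_iff by (metis one_add_one)
    then show False using A(2) by (auto dest: dvd_imp_le)
  qed
  have "\<exists>k. [a = g ^ k] (mod A * B) \<or> A * B dvd a + g ^ k" if a: "coprime a (A * B)" for a
  proof -
    obtain i where i: "[a = x ^ i] (mod A)" using primroot_generates[OF A(1), of a] A(2) a by auto
    obtain j where j: "[a = y ^ j] (mod B)" using primroot_generates[OF B(1), of a] B(2) a by auto
    show ?thesis
    proof (cases "even i")
      case True
      then obtain k where "[g ^ k = x ^ i] (mod A)" "[g ^ k = y ^ j] (mod B)" using solve by blast
      then have "[a = g ^ k] (mod A)" "[a = g ^ k] (mod B)" using i j by (metis cong_sym cong_trans)+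
      then show ?thesis using cop by (blast intro: coprime_cong_mult_nat)
    next
      case False
      \<comment> \<open>Multiplication by -1, which is \<open>x ^ e\<close> modulo A and
        \<open>y ^ e'\<close> modulo B, makes the exponent of x even, so \<open>solve\<close>
        applies to -a.\<close>
      then have "even (i + e)" using \<open>odd e\<close> by simp
      then obtain k where k: "[g ^ k = x ^ (i + e)] (mod A)" "[g ^ k = y ^ (j + e')] (mod B)"
        using solve by blast
      have "A dvd a + g ^ k"
        by (rule dvd_add_cong[OF cong_minus_1_mult[OF e, of i]]) (use i k in \<open>simp_all add: cong_sym_eq\<close>)
      moreover have "B dvd a + g ^ k"
        by (rule dvd_add_cong[OF cong_minus_1_mult[OF e', of j]]) (use j k in \<open>simp_all add: cong_sym_eq\<close>)
      ultimately show ?thesis using cop by (blast intro: divides_mult)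
    qed
  qed
  then show ?thesis using gcop unfolding cyclic_mod_pm1_def by blast
qed

text \<open>Odd d leaves only the forms \<open>p ^ a\<close> and \<open>p ^ a * q ^ b\<close>. In
  the second the halved totients are coprime, so one of them is odd, and its prime power plays the
  role of A in \<open>cyclic_mod_pm1_mult\<close>.\<close>

lemma cyclic_mod_pm1_if_condition_C:
  assumes "condition_C d" "odd d"
  shows "cyclic_mod_pm1 d"
proof -
  have root: "\<exists>x. residue_primroot (p ^ a) x \<and> p ^ a > 2" if pr: "prime p" "odd p" "a > 0" for p a :: nat
  proof -
    obtain x where "\<forall>k>0. residue_primroot (p ^ k) x"
      using residue_primroot_odd_prime_power_exists[OF pr(1,2)] by blast
    moreover have "p > 2" using pr prime_ge_2_nat[of p] by (cases "p = 2") auto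
    then have "p ^ a > 2" using pr(3) self_le_power[of p a] by simp
    ultimately show ?thesis using pr(3) by blast
  qed
  have "d > 1" using assms(1) by (simp add: condition_C_def)
  consider p a where "prime p" "odd p" "a > 0" "d = p ^ a"
    | p q a b where "prime p" "odd p" "prime q" "odd q" "p \<noteq> q" "a > 0" "b > 0"
      "gcd (totient (p ^ a)) (totient (q ^ b)) = 2" "d = p ^ a * q ^ b"
    using assms unfolding condition_C_def by auto
  then show ?thesis
  proof cases
    case 1
    then obtain x where x: "residue_primroot d x" using root by blast
    have "\<exists>k. [a = x ^ k] (mod d) \<or> d dvd a + x ^ k" if "coprime a d" for a
      using primroot_generates[OF x \<open>d > 1\<close> that] by blast
    moreover have "coprime x d" using x by (simp add: residue_primroot_def coprime_commute)
    ultimately show ?thesis unfolding cyclic_mod_pm1_def by blast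
  next
    case 2
    let ?A = "p ^ a" and ?B = "q ^ b"
    obtain x y where x: "residue_primroot ?A x" "?A > 2" and y: "residue_primroot ?B y" "?B > 2"
      using root 2 by metis
    have cop: "coprime ?A ?B" using 2 by (simp add: primes_coprime)
    have "even (totient ?A)" "even (totient ?B)" using x y by (simp_all add: totient_even)
    then obtain s t where s: "totient ?A = 2 * s" and t: "totient ?B = 2 * t" by (elim evenE)
    have "gcd (2 * s) (2 * t) = 2" using 2 by (simp add: s t)
    then have st: "coprime s t" by (simp add: gcd_mult_distrib_nat[symmetric] coprime_iff_gcd_eq_1)
    then consider "odd s" | "odd t" by (metis coprime_common_divisor_nat odd_one dvd_1_iff_1 even_numeral numeral_One  numeral_eq_one_iff semiring_norm(85))
    then show ?thesis
    proof cases
      case 1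
      then have "coprime s (totient ?B)" using st by (simp add: t)
      then show ?thesis unfolding \<open>d = p ^ a * q ^ b\<close> using x y cop s 1 by (intro cyclic_mod_pm1_mult)
    next
      case 2
      then have "coprime t (totient ?A)" using st by (simp add: s coprime_commute)
      then have "cyclic_mod_pm1 (?B * ?A)"
        using x y cop t 2 by (intro cyclic_mod_pm1_mult) (simp_all add: coprime_commute)
      then show ?thesis unfolding \<open>d = p ^ a * q ^ b\<close> by (simp add: mult.commute)
    qed
  qed
qed

section \<open>The maximal real subfield\<close>

abbreviation rpoly :: "rat poly \<Rightarrow> complex \<Rightarrow> complex" where
  "rpoly h z \<equiv> poly (map_poly of_rat h) z"

lemma rat_poly_common_denominator:
  "\<exists>n>0. \<exists>g::int poly. smult (of_nat n) h = map_poly of_int g" for h :: "rat poly"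
proof (induction h)
  case 0
  show ?case by (intro exI[of _ 1] conjI exI[of _ 0]) auto
next
  case (pCons c h)
  then obtain n g where g: "n > 0" "smult (of_nat n) h = map_poly of_int g" by blast
  obtain a b :: int where ab: "b > 0" "c = of_int a / of_int b"
    by (metis Fract_of_int_quotient Rat_cases)
  have "smult (of_nat (n * nat b)) (pCons c h) =
      map_poly of_int (pCons (a * int n) (smult b g))"
    using ab g by (simp add: hom_distribs flip: g(2)) (simp add: mult_ac)
  then show ?case using g ab by (intro exI[of _ "n * nat b"]) auto
qed

lemma rpoly_common_denominator:
  obtains n g where "n > 0" "\<And>z. of_nat n * rpoly h z = ipoly g z"
    "smult (of_nat n) h = map_poly of_int g"
proof -
  obtain n g where g: "n > 0" "smult (of_nat n) h = map_poly of_int g"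
    using rat_poly_common_denominator[of h] by blast
  have "of_nat n * rpoly h z = ipoly g z" for z
  proof -
    have "ipoly g z = rpoly (smult (of_nat n) h) z"
      unfolding g(2) by (simp add: map_poly_map_poly o_def)
    then show ?thesis by (simp add: hom_distribs)
  qed
  with g show ?thesis by (intro that)
qed

lemma (in complex_subring) numeral_closed [simp]: "numeral n \<in> R"
  using of_nat_closed[of "numeral n"] by simp

lemma ipoly_conv_rpoly: "ipoly h z = rpoly (map_poly of_int h) z"
  by (simp add: map_poly_map_poly o_def)

lemma cnj_of_rat: "cnj (of_rat q) = of_rat q"
  by (cases q) (simp add: of_rat_rat)

text \<open>Keeps \<open>\<theta> 1\<close> below from being rewritten to \<open>\<theta> (Suc 0)\<close>.\<close>

declare One_nat_def [simp del]

interpretation of_rat_poly_hom: map_poly_inj_idom_hom "of_rat :: rat \<Rightarrow> complex" ..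

locale odd_unity_root = unity_root +
  assumes d_odd: "odd d" and d_gt_1: "d > 1"
begin

definition \<theta> :: "nat \<Rightarrow> complex" where
  "\<theta> a = 2 - \<eta> ^ a - inverse (\<eta> ^ a)"

definition conjugates :: "complex set" where
  "conjugates = \<theta> ` {a. coprime a d}"

lemma d_gt_2: "d > 2"
  using d_odd d_gt_1 by (cases "d = 2") auto

lemma conjugate_odd: "coprime a d \<Longrightarrow> odd_unity_root (\<eta> ^ a) d"
  using conjugate[of a] d_odd d_gt_1 by (simp add: odd_unity_root_def odd_unity_root_axioms_def)

lemma inverse_power: "inverse (\<eta> ^ a) = \<eta> ^ (a * (d - 1))"
proof -
  have "\<eta> ^ a * \<eta> ^ (a * (d - 1)) = \<eta> ^ (d * a)"
  proof -
    have "a + a * (d - 1) = d * a" using d_pos by (cases d) auto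
    then show ?thesis by (simp flip: power_add)
  qed
  also have "\<dots> = 1" by (simp add: power_mult)
  finally show ?thesis by (rule inverse_unique)
qed

text \<open>With \<open>x = \<eta> ^ a\<close> and \<open>y = \<eta> ^ b\<close>, the difference
  factors: \<open>(\<theta> b - \<theta> a) * (x * y) = (x - y) * (x * y - 1)\<close>.\<close>

lemma \<theta>_eq_iff: "\<theta> a = \<theta> b \<longleftrightarrow> [a = b] (mod d) \<or> d dvd a + b"
proof -
  let ?x = "\<eta> ^ a" and ?y = "\<eta> ^ b"
  have nz: "?x \<noteq> 0" "?y \<noteq> 0" by auto
  have "(\<theta> b - \<theta> a) * (?x * ?y) = (?x - ?y) * (?x * ?y) + (inverse ?x - inverse ?y) * (?x * ?y)"
    by (simp add: \<theta>_def algebra_simps)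
  also have "(inverse ?x - inverse ?y) * (?x * ?y) = inverse ?x * ?x * ?y - inverse ?y * ?y * ?x"
    by (simp only: left_diff_distrib right_diff_distrib mult_ac)
  also have "\<dots> = ?y - ?x" using nz by simp
  also have "(?x - ?y) * (?x * ?y) + (?y - ?x) = (?x - ?y) * (?x * ?y - 1)"
    by (simp add: algebra_simps)
  finally have "\<theta> a = \<theta> b \<longleftrightarrow> ?x = ?y \<or> ?x * ?y = 1" using nz by auto
  also have "?x = ?y \<longleftrightarrow> [a = b] (mod d)" by (rule power_eq_iff)
  also have "?x * ?y = 1 \<longleftrightarrow> d dvd a + b" by (simp only: power_eq_1_iff flip: power_add)
  finally show ?thesis .
qed

lemma cnj_root: "cnj \<eta> = inverse \<eta>"
proof -
  have "norm (\<eta> ^ d) = 1" by (simp only: power_d norm_one)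
  then have "norm \<eta> ^ d = 1 ^ d" by (simp only: norm_power power_one)
  then have "norm \<eta> = 1" by (rule power_eq_imp_eq_base[OF _ norm_ge_zero zero_le_one d_pos])
  have "\<eta> * cnj \<eta> = of_real ((norm \<eta>)\<^sup>2)" by (rule complex_norm_square[symmetric])
  also have "\<dots> = 1" using \<open>norm \<eta> = 1\<close> by simp
  finally have "\<eta> * cnj \<eta> = 1" .
  then show ?thesis by (rule inverse_unique[symmetric])
qed

lemma cnj_\<theta> [simp]: "cnj (\<theta> a) = \<theta> a"
  by (simp add: \<theta>_def cnj_root power_inverse)

lemma coprime_diff_d:
  assumes "r < d" "coprime r d"
  shows "coprime (d - r) d"
proof (rule coprimeI)
  fix c assume c: "c dvd d - r" "c dvd d"
  then have "c dvd r" using assms(1) by (intro dvd_diffD1[of c d r]) auto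
  then show "is_unit c" using c(2) assms(2) by (rule coprime_common_divisor[rotated])
qed

lemma coprime_mod_pos: "coprime a d \<Longrightarrow> a mod d > 0"
proof (rule Nat.gr0I)
  assume "coprime a d" "a mod d = 0"
  then have "d dvd a" "d dvd d" by auto
  then have "is_unit d" using \<open>coprime a d\<close> by (rule coprime_common_divisor[rotated])
  then show False using d_gt_1 by simp
qed

text \<open>As d is odd, exactly one of m and \<open>d - m\<close> is odd, so these m represent the
  units modulo d up to sign; they are the index set of \<open>Omega d\<close>.\<close>

definition odd_totatives :: "nat set" where
  "odd_totatives = {m. 1 \<le> m \<and> m < d \<and> odd m \<and> coprime m d}"

lemma finite_odd_totatives [simp]: "finite odd_totatives"
  unfolding odd_totatives_def by (rule finite_subset[of _ "{..<d}"]) auto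

lemma inj_on_\<theta>_odd: "inj_on \<theta> odd_totatives"
proof (rule inj_onI)
  fix a b assume *: "a \<in> odd_totatives" "b \<in> odd_totatives" "\<theta> a = \<theta> b"
  have "\<not> d dvd a + b"
  proof
    assume "d dvd a + b"
    then obtain k where k: "a + b = d * k" by blast
    have "a + b < d * 2" "a + b > 0" using * by (auto simp: odd_totatives_def)
    then have "k = 1" unfolding k by (auto simp: less_2_cases_iff)
    then show False using k * d_odd by (auto simp: odd_totatives_def)
  qed
  then have "[a = b] (mod d)" using * by (simp add: \<theta>_eq_iff)
  then show "a = b" using * by (auto simp: odd_totatives_def cong_less_modulus_unique_nat)
qed

lemma conjugates_eq_odd: "conjugates = \<theta> ` odd_totatives"
proof
  show "\<theta> ` odd_totatives \<subseteq> conjugates" by (auto simp: conjugates_def odd_totatives_def)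
  show "conjugates \<subseteq> \<theta> ` odd_totatives"
  proof
    fix x assume "x \<in> conjugates"
    then obtain a where a: "coprime a d" "x = \<theta> a" by (auto simp: conjugates_def)
    define r where "r = a mod d"
    have r: "r > 0" "r < d" "coprime r d" using a coprime_mod_pos[of a] d_pos by (auto simp: r_def)
    show "x \<in> \<theta> ` odd_totatives"
    proof (cases "odd r")
      case True
      then have "r \<in> odd_totatives" using r by (simp add: odd_totatives_def)
      moreover have "\<theta> a = \<theta> r" by (simp add: \<theta>_eq_iff r_def cong_def)
      ultimately show ?thesis using a by blast
    next
      case False
      have "coprime (d - r) d" using r by (intro coprime_diff_d)
      then have "d - r \<in> odd_totatives" using r False d_odd by (simp add: odd_totatives_def)
      moreover have "\<theta> a = \<theta> (d - r)"
      proof -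
        have "[a + (d - r) = r + (d - r)] (mod d)" by (intro cong_add) (auto simp: r_def cong_def)
        then have "d dvd a + (d - r)" using r by (simp add: cong_def dvd_eq_mod_eq_0)
        then show ?thesis by (simp add: \<theta>_eq_iff)
      qed
      ultimately show ?thesis using a by blast
    qed
  qed
qed

lemma finite_conjugates [simp]: "finite conjugates"
  by (simp add: conjugates_eq_odd)

lemma card_odd_totatives: "2 * card odd_totatives = totient d"
proof -
  have "totatives d = odd_totatives \<union> (\<lambda>m. d - m) ` odd_totatives"
  proof (intro equalityI subsetI)
    fix m assume m: "m \<in> totatives d"
    then have "m \<noteq> d" using d_gt_1 by (auto simp: totatives_def)
    then have m': "m > 0" "m < d" "coprime m d" using m by (auto simp: totatives_def)
    show "m \<in> odd_totatives \<union> (\<lambda>m. d - m) ` odd_totatives"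
    proof (cases "odd m")
      case False
      then have "d - m \<in> odd_totatives" using m' d_odd coprime_diff_d by (simp add: odd_totatives_def)
      moreover have "m = d - (d - m)" using m' by simp
      ultimately show ?thesis by blast
    qed (use m' in \<open>simp add: odd_totatives_def\<close>)
  next
    fix m assume "m \<in> odd_totatives \<union> (\<lambda>m. d - m) ` odd_totatives"
    then show "m \<in> totatives d" using coprime_diff_d by (auto simp: odd_totatives_def totatives_def)
  qed
  moreover have "odd_totatives \<inter> (\<lambda>m. d - m) ` odd_totatives = {}"
    using d_odd by (auto simp: odd_totatives_def)
  moreover have "card ((\<lambda>m. d - m) ` odd_totatives) = card odd_totatives"
    by (intro card_image inj_onI) (auto simp: odd_totatives_def)
  ultimately show ?thesis by (simp add: totient_def card_Un_disjoint)
qed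

lemma card_conjugates: "2 * card conjugates = totient d"
  by (simp add: conjugates_eq_odd card_image[OF inj_on_\<theta>_odd] card_odd_totatives)

section \<open>Conjugation of polynomial relations among the \<theta>\<close>

lemma \<theta>_in_Zadj_\<eta>: "\<theta> a \<in> Zadj \<eta>"
  by (simp add: \<theta>_def inverse_power)

text \<open>P depends on b alone; this uniformity in a allows a relation at \<open>\<eta>\<close> to
  be read at the conjugate \<open>\<eta> ^ a\<close>.\<close>

lemma \<theta>_as_ipoly:
  obtains P where "\<And>a. ipoly P (\<eta> ^ a) = \<theta> (a * b)"
proof
  fix a
  show "ipoly (2 - monom 1 b - monom 1 (b * (d - 1))) (\<eta> ^ a) = \<theta> (a * b)"
    by (simp add: \<theta>_def inverse_power hom_distribs poly_monom mult_ac flip: power_mult)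
qed

text \<open>The assumed relation says that one integer polynomial vanishes at \<open>\<eta>\<close>,
  so it vanishes at \<open>\<eta> ^ a\<close> too.\<close>

lemma ipoly_\<theta>_transfer:
  assumes "ipoly h (\<theta> 1) = ipoly k (\<theta> b)" "coprime a d"
  shows "ipoly h (\<theta> a) = ipoly k (\<theta> (a * b))"
proof -
  obtain P where P: "\<And>a. ipoly P (\<eta> ^ a) = \<theta> (a * 1)" using \<theta>_as_ipoly[of 1] by blast
  obtain Q where Q: "\<And>a. ipoly Q (\<eta> ^ a) = \<theta> (a * b)" using \<theta>_as_ipoly[of b] by blast
  have "ipoly (pcompose h P - pcompose k Q) \<eta> = 0"
    using assms(1) P[of 1] Q[of 1] by (simp add: of_int_poly_hom.hom_minus ipoly_pcompose)
  then have "ipoly (pcompose h P - pcompose k Q) (\<eta> ^ a) = 0"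
    using assms(2) by (rule ipoly_root_conjugate)
  then show ?thesis
    using P[of a] Q[of a] by (simp add: of_int_poly_hom.hom_minus ipoly_pcompose)
qed

lemma rpoly_\<theta>_transfer:
  assumes "rpoly h (\<theta> 1) = rpoly k (\<theta> b)" "coprime a d"
  shows "rpoly h (\<theta> a) = rpoly k (\<theta> (a * b))"
proof -
  obtain m g where g: "m > 0" "\<And>z. of_nat m * rpoly h z = ipoly g z"
    using rpoly_common_denominator[of h] by metis
  obtain n l where l: "n > 0" "\<And>z. of_nat n * rpoly k z = ipoly l z"
    using rpoly_common_denominator[of k] by metis
  have *: "ipoly (smult (int n) g) z = of_nat (m * n) * rpoly h z"
          "ipoly (smult (int m) l) z = of_nat (m * n) * rpoly k z" for z
    by (simp_all add: hom_distribs flip: g(2) l(2))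
  have "ipoly (smult (int n) g) (\<theta> a) = ipoly (smult (int m) l) (\<theta> (a * b))"
    using assms by (intro ipoly_\<theta>_transfer) (simp_all only: *)
  then show ?thesis using g(1) l(1) by (simp only: *) simp
qed

lemma ipoly_\<theta>_root: "ipoly h (\<theta> 1) = 0 \<Longrightarrow> coprime a d \<Longrightarrow> ipoly h (\<theta> a) = 0"
  using ipoly_\<theta>_transfer[of h 0 1 a] by simp

lemma degree_ge_if_root:
  assumes "h \<noteq> 0" "ipoly h (\<theta> 1) = 0"
  shows "card conjugates \<le> Polynomial.degree h"
proof -
  have h0: "map_poly of_int h \<noteq> (0 :: complex poly)" using assms(1) by simp
  have "conjugates \<subseteq> {z. ipoly h z = 0}"
    using assms(2) by (auto simp: conjugates_def ipoly_\<theta>_root)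
  then have "card conjugates \<le> card {z. ipoly h z = 0}"
    using h0 by (intro card_mono poly_roots_finite)
  also have "\<dots> \<le> Polynomial.degree (map_poly of_int h :: complex poly)"
    by (rule card_poly_roots_bound[OF h0])
  finally show ?thesis by simp
qed

text \<open>The sums of \<open>\<eta> ^ n\<close> and its inverse satisfy the Chebyshev recurrence
  with multiplier \<open>2 - \<theta> 1\<close>, here rewritten for \<open>\<theta>\<close>.\<close>

lemma \<theta>_in_Zadj: "\<theta> a \<in> Zadj (\<theta> 1)"
proof (induction a rule: less_induct)
  case (less a)
  consider "a = 0" | "a = 1" | b where "a = Suc (Suc b)"
    by (metis One_nat_def not0_implies_Suc)
  then show ?case
  proof cases
    case 3
    have "\<theta> a = 2 * \<theta> 1 + 2 * \<theta> (Suc b) - \<theta> 1 * \<theta> (Suc b) - \<theta> b"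
    proof -
      define x y where "x = \<eta>" and "y = inverse \<eta>"
      have "x * y = 1" by (simp add: x_def y_def)
      have \<theta>: "\<theta> n = 2 - x ^ n - y ^ n" for n by (simp add: \<theta>_def x_def y_def power_inverse)
      have "2 - x * (x * s) - y * (y * t) =
        2 * (2 - x - y) + 2 * (2 - x * s - y * t) - (2 - x - y) * (2 - x * s - y * t) - (2 - s - t)"
        for s t
      proof -
        have "(x + y) * (x * s + y * t) = x * (x * s) + y * (y * t) + x * y * (s + t)"
          by (simp only: algebra_simps)
        then have "x * (x * s) + y * (y * t) = (x + y) * (x * s + y * t) - (s + t)"
          unfolding \<open>x * y = 1\<close> by simp
        then show ?thesis by (simp add: algebra_simps)
      qed
      then show ?thesis by (simp only: 3 \<theta> power_Suc power_one_right)
    qed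
    also have "\<dots> \<in> Zadj (\<theta> 1)" using 3 less[of b] less[of "Suc b"]
      by simp
    finally show ?thesis .
  qed (simp_all add: \<theta>_def)
qed

text \<open>\<open>\<int>[\<eta>] = \<int>[\<theta>] + \<int>[\<theta>]\<eta>\<close>, and complex conjugation recovers the summands.\<close>

lemma real_in_Zadj:
  assumes "x \<in> Zadj \<eta>" "cnj x = x"
  shows "x \<in> Zadj (\<theta> 1)"
proof -
  obtain h where h: "x = ipoly h \<eta>" using assms(1) by (rule ZadjE)
  have "\<exists>u\<in>Zadj (\<theta> 1). \<exists>v\<in>Zadj (\<theta> 1). ipoly h \<eta> = u + v * \<eta>"
  proof (induction h)
    case 0
    show ?case by (intro bexI[of _ 0]) auto
  next
    case (pCons c h)
    then obtain u v where uv: "u \<in> Zadj (\<theta> 1)" "v \<in> Zadj (\<theta> 1)" "ipoly h \<eta> = u + v * \<eta>" by blast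
    \<comment> \<open>The quadratic equation of \<open>\<eta>\<close> over \<int>[\<theta> 1]
      preserves the form \<open>u + v * \<eta>\<close> under multiplication by
      \<open>\<eta>\<close>.\<close>
    have sq: "\<eta> * \<eta> = (2 - \<theta> 1) * \<eta> - 1" by (simp add: \<theta>_def distrib_right)
    have "ipoly (pCons c h) \<eta> = of_int c + u * \<eta> + v * (\<eta> * \<eta>)"
      using uv(3) by (simp add: hom_distribs algebra_simps)
    also have "\<dots> = (of_int c - v) + (u + v * (of_nat 2 - \<theta> 1)) * \<eta>"
      unfolding sq by (simp add: algebra_simps)
    finally show ?case using uv(1,2)
      by (intro bexI[of _ "of_int c - v"] bexI[of _ "u + v * (of_nat 2 - \<theta> 1)"]) auto
  qed
  then obtain u v where uv: "u \<in> Zadj (\<theta> 1)" "v \<in> Zadj (\<theta> 1)" "x = u + v * \<eta>" using h by blast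
  have real: "cnj y = y" if y: "y \<in> Zadj (\<theta> 1)" for y
  proof -
    obtain k where "y = ipoly k (\<theta> 1)" using y by (rule ZadjE)
    moreover have "cnj (ipoly k (\<theta> 1)) = ipoly k (\<theta> 1)"
      by (induction k) (simp_all add: hom_distribs)
    ultimately show ?thesis by simp
  qed
  \<comment> \<open>Conjugation fixes u and v and inverts \<open>\<eta>\<close>. Since
    \<open>d > 2\<close>, \<open>\<eta>\<close> differs from its inverse, which forces v =
    0.\<close>
  have "u + v * inverse \<eta> = u + v * \<eta>"
    using assms(2) unfolding uv(3) by (simp add: real uv(1,2) cnj_root)
  moreover have "\<eta> \<noteq> inverse \<eta>"
  proof
    assume "\<eta> = inverse \<eta>"
    then have "\<eta> ^ 2 = 1" by (metis nonzero power2_eq_square right_inverse)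
    then have "d \<le> 2" unfolding power_eq_1_iff by (intro dvd_imp_le) auto
    then show False using d_gt_2 by simp
  qed
  ultimately have "v = 0" by auto
  then show ?thesis using uv by simp
qed

section \<open>The field \<rat>(\<theta> 1) and its ring of integers\<close>

definition K :: "complex set" where
  "K = range (\<lambda>h. rpoly h (\<theta> 1))"

lemma rpoly_in_K [simp]: "rpoly h (\<theta> 1) \<in> K"
  by (simp add: K_def)

lemma K_denominator:
  assumes "x \<in> K"
  obtains n where "n > 0" "of_nat n * x \<in> Zadj (\<theta> 1)"
proof -
  obtain h where h: "x = rpoly h (\<theta> 1)" using assms by (auto simp: K_def)
  obtain n g where "n > 0" "\<And>z. of_nat n * rpoly h z = ipoly g z"
    using rpoly_common_denominator[of h] by metis
  then show ?thesis using h by (intro that[of n]) auto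
qed

lemma Zadj_subset_K: "Zadj (\<theta> 1) \<subseteq> K"
  by (auto simp: Zadj_def ipoly_conv_rpoly)

lemma Zadj_\<theta>_subset: "Zadj (\<theta> 1) \<subseteq> Zadj \<eta>"
  by (rule Zadj_mono[OF \<theta>_in_Zadj_\<eta>])

lemma Rats_subset_K: "\<rat> \<subseteq> K"
proof
  fix x :: complex assume "x \<in> \<rat>"
  then obtain q where "x = of_rat q" by (rule Rats_cases)
  then have "x = rpoly [:q:] (\<theta> 1)" by (simp add: hom_distribs)
  then show "x \<in> K" by (simp only: rpoly_in_K)
qed

lemma K_closed:
  assumes "x \<in> K" "y \<in> K"
  shows "x + y \<in> K" "x * y \<in> K" "- x \<in> K"
proof -
  obtain g h where gh: "x = rpoly g (\<theta> 1)" "y = rpoly h (\<theta> 1)" using assms by (auto simp: K_def)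
  show "x + y \<in> K" "x * y \<in> K" "- x \<in> K"
    using rpoly_in_K[of "g + h"] rpoly_in_K[of "g * h"] rpoly_in_K[of "- g"]
    by (simp_all add: gh hom_distribs)
qed

text \<open>For nonzero x with n x in \<int>[\<theta> 1], some nonzero integer c has the form n x r
  with r in \<int>[\<theta> 1]; the inverse is then (n / c) r.\<close>

lemma K_inverse_closed:
  assumes "x \<in> K"
  shows "inverse x \<in> K"
proof (cases "x = 0")
  case False
  obtain n where n: "n > 0" "of_nat n * x \<in> Zadj (\<theta> 1)" using assms by (rule K_denominator)
  have "\<exists>c. c \<noteq> 0 \<and> Zadj.dvdR (\<theta> 1) (of_nat n * x) (of_int c)"
    using n False Zadj_\<theta>_subset by (intro Zadj.dvdR_nonzero_int) (auto intro: algebraic_int_Zadj)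
  then obtain c r where c: "c \<noteq> 0" "r \<in> Zadj (\<theta> 1)" "of_int c = of_nat n * x * r"
    by (auto simp: Zadj.dvdR_def)
  then have "r \<noteq> 0" by auto
  with c(3) have "inverse x = (of_nat n / of_int c) * r"
    using False n by (simp add: field_simps)
  moreover have "(of_nat n / of_int c :: complex) \<in> K" using Rats_subset_K by auto
  ultimately show ?thesis using c(2) Zadj_subset_K K_closed(2) by (metis subsetD)
qed (use assms in auto)

lemma cnj_K: "x \<in> K \<Longrightarrow> cnj x = x"
proof -
  assume "x \<in> K"
  then obtain h where "x = rpoly h (\<theta> 1)" by (auto simp: K_def)
  moreover have "cnj (rpoly h (\<theta> 1)) = rpoly h (\<theta> 1)"
    by (induction h) (simp_all add: hom_distribs map_poly_pCons cnj_of_rat)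
  ultimately show ?thesis by simp
qed

text \<open>An integral element of K lies in \<int>[\<eta>] by integral closedness and is real, so
  it already lies in \<int>[\<theta> 1].\<close>

lemma ring_of_integers_K: "{x \<in> K. algebraic_int x} = Zadj (\<theta> 1)"
proof (intro equalityI subsetI CollectI conjI)
  fix x assume x: "x \<in> {x \<in> K. algebraic_int x}"
  then obtain n where n: "n > 0" "of_nat n * x \<in> Zadj (\<theta> 1)" by (auto elim: K_denominator)
  have "x \<in> Zadj \<eta>"
    using x n Zadj_\<theta>_subset by (intro Zadj_integrally_closed[of x n]) auto
  then show "x \<in> Zadj (\<theta> 1)" using x cnj_K by (intro real_in_Zadj) auto
next
  fix x assume "x \<in> Zadj (\<theta> 1)"
  then show "x \<in> K" "algebraic_int x"
    using Zadj_subset_K Zadj_\<theta>_subset algebraic_int_Zadj by auto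
qed

text \<open>Leaving S open covers both \<open>{\<theta> 1}\<close> and the full root set, so K is
  the field of one root and also the splitting field.\<close>

lemma adjoin_eq_K:
  assumes "S \<subseteq> K" "\<theta> 1 \<in> S"
  shows "adjoin S = K"
proof
  interpret F: Ring.field "ring_of_type_algebra :: complex ring" by (rule field_from_type_algebra)
  have simps: "monoid.mult (ring_of_type_algebra :: complex ring) = (*)"
    "\<zero>\<^bsub>ring_of_type_algebra\<^esub> = (0::complex)" "\<one>\<^bsub>ring_of_type_algebra\<^esub> = (1::complex)"
    "ring.add (ring_of_type_algebra :: complex ring) = (+)" "carrier (ring_of_type_algebra :: complex ring) = UNIV"
    by (simp_all add: ring_of_type_algebra_def)
  have minus: "\<ominus>\<^bsub>ring_of_type_algebra\<^esub> x = - x" for x :: complex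
    by (rule F.minus_equality) (simp_all add: simps)
  have inv: "inv\<^bsub>ring_of_type_algebra\<^esub> x = inverse x" if "x \<noteq> 0" for x :: complex
    using that by (intro F.comm_inv_char) (simp_all add: simps)
  show "adjoin S \<subseteq> K"
  proof
    fix x assume "x \<in> adjoin S"
    then show "x \<in> K" unfolding adjoin_def
    proof (induction rule: generate_field.induct)
      case (m_inv h)
      then show ?case using inv[of h] K_inverse_closed by (simp add: simps)
    qed (use assms(1) Rats_subset_K in \<open>auto simp: simps minus K_closed\<close>)
  qed
  show "K \<subseteq> adjoin S"
  proof
    fix x assume "x \<in> K"
    then obtain h where h: "x = rpoly h (\<theta> 1)" by (auto simp: K_def)
    have \<theta>: "\<theta> 1 \<in> adjoin S" using assms(2) by (auto simp: adjoin_def intro: generate_field.incl)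
    have "rpoly h (\<theta> 1) \<in> adjoin S"
    proof (induction h)
      case 0
      then show ?case by (auto simp: adjoin_def intro!: generate_field.incl)
    next
      case (pCons c h)
      have "of_rat c \<in> adjoin S" by (auto simp: adjoin_def intro!: generate_field.incl)
      with pCons \<theta> show ?case
        unfolding adjoin_def
        using generate_field.eng_add[of "of_rat c" ring_of_type_algebra "\<rat> \<union> S" "\<theta> 1 * rpoly h (\<theta> 1)"]
          generate_field.eng_mult[of "\<theta> 1" ring_of_type_algebra "\<rat> \<union> S" "rpoly h (\<theta> 1)"]
        by (simp add: simps hom_distribs)
    qed
    then show "x \<in> adjoin S" by (simp add: h)
  qed
qed

end

section \<open>Irreducibility and monogenicity\<close>

context odd_unity_root
begin

lemma card_conjugates_pos: "card conjugates > 0"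
  using d_gt_1 card_conjugates by (intro Nat.gr0I) simp

text \<open>A factor vanishing at \<open>\<theta> 1\<close> has, after clearing denominators, degree
  at least \<open>card conjugates\<close>, which is the degree of f; the other factor is
  constant.\<close>

lemma irreducible_if_root:
  assumes f: "lead_coeff f = 1" "Polynomial.degree f = card conjugates" "ipoly f (\<theta> 1) = 0"
  shows "irreducible_over_Q f"
proof (rule Factorial_Ring.irreducibleI)
  let ?f = "map_poly of_int f :: rat poly"
  have f0: "f \<noteq> 0" using f(1) by auto
  then show "?f \<noteq> 0" by simp
  have "Polynomial.degree ?f > 0" using f(2) card_conjugates_pos by simp
  then show "\<not> is_unit ?f" using \<open>?f \<noteq> 0\<close> by (simp add: is_unit_iff_degree)
  fix a b assume ab: "?f = a * b"
  have nz: "a \<noteq> 0" "b \<noteq> 0" using ab \<open>?f \<noteq> 0\<close> by auto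
  have deg: "Polynomial.degree f = Polynomial.degree a + Polynomial.degree b"
    using arg_cong[OF ab, of Polynomial.degree] nz by (simp add: degree_mult_eq)
  have key: "card conjugates \<le> Polynomial.degree h" if h: "rpoly h (\<theta> 1) = 0" "h \<noteq> 0" for h
  proof -
    obtain n g where g: "n > 0" "\<And>z. of_nat n * rpoly h z = ipoly g z"
      "smult (of_nat n) h = map_poly of_int g"
      using rpoly_common_denominator[of h] by metis
    have "g \<noteq> 0" using g(1,3) h(2) by auto
    moreover have "ipoly g (\<theta> 1) = 0" using g(2)[of "\<theta> 1"] h(1) by simp
    ultimately have "card conjugates \<le> Polynomial.degree g" by (rule degree_ge_if_root)
    also have "\<dots> = Polynomial.degree (smult (of_nat n) h)" unfolding g(3) by simp
    also have "\<dots> = Polynomial.degree h" using g(1) by simp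
    finally show ?thesis .
  qed
  have "rpoly (a * b) (\<theta> 1) = 0"
    using f(3) unfolding ab[symmetric] by (simp add: map_poly_map_poly o_def)
  then have "rpoly a (\<theta> 1) = 0 \<or> rpoly b (\<theta> 1) = 0" by (simp add: hom_distribs)
  then have "Polynomial.degree b = 0 \<or> Polynomial.degree a = 0"
    using key[of a] key[of b] nz deg f(2) by linarith
  then show "is_unit a \<or> is_unit b" using nz by (auto simp: is_unit_iff_degree)
qed

lemma powers_independent:
  assumes "(\<Sum>i<card conjugates. of_int (c i) * \<theta> 1 ^ i) = 0" "i < card conjugates"
  shows "c i = 0"
proof (rule ccontr)
  assume ci: "c i \<noteq> 0"
  let ?n = "card conjugates"
  define h where "h = (\<Sum>i<?n. monom (c i) i)"
  have coeff: "coeff h j = (if j < ?n then c j else 0)" for j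
    by (simp add: h_def coeff_sum coeff_monom)
  have "h \<noteq> 0" using coeff[of i] ci assms(2) by auto
  moreover have "ipoly h (\<theta> 1) = 0"
    using assms(1) by (simp add: h_def hom_distribs poly_sum poly_monom)
  ultimately have "?n \<le> Polynomial.degree h" by (rule degree_ge_if_root)
  then have "lead_coeff h = 0" by (simp add: coeff)
  then show False using \<open>h \<noteq> 0\<close> by simp
qed

lemma Z_basis_powers:
  assumes f: "lead_coeff f = 1" "Polynomial.degree f = card conjugates" "ipoly f (\<theta> 1) = 0"
  shows "Z_basis {\<theta> 1 ^ i | i. i < card conjugates} (Zadj (\<theta> 1))"
proof -
  let ?n = "card conjugates" and ?B = "{\<theta> 1 ^ i | i. i < card conjugates}"
  interpret M: Modules.module int_scale by (rule module_int_scale)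
  have inj: "inj_on (\<lambda>i. \<theta> 1 ^ i) {..<?n}"
  proof (rule inj_onI, rule ccontr)
    fix i j assume ij: "i \<in> {..<?n}" "j \<in> {..<?n}" "\<theta> 1 ^ i = \<theta> 1 ^ j" "i \<noteq> j"
    define c :: "nat \<Rightarrow> int" where "c = (\<lambda>k. (if k = i then 1 else 0) - (if k = j then 1 else 0))"
    have "(\<Sum>k<?n. of_int (c k) * \<theta> 1 ^ k) = (\<Sum>k<?n. (if k = i then \<theta> 1 ^ k else 0) - (if k = j then \<theta> 1 ^ k else 0))"
      by (intro sum.cong) (auto simp: c_def)
    also have "\<dots> = \<theta> 1 ^ i - \<theta> 1 ^ j" using ij by (simp add: sum_subtractf)
    finally have "c i = 0" using ij by (intro powers_independent) auto
    then show False using ij by (simp add: c_def)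
  qed
  have B: "?B = (\<lambda>i. \<theta> 1 ^ i) ` {..<?n}" by auto
  have "\<not> M.dependent ?B"
  proof
    assume "M.dependent ?B"
    then obtain t u v where t: "finite t" "t \<subseteq> ?B" "(\<Sum>v\<in>t. of_int (u v) * v) = 0" "v \<in> t" "u v \<noteq> 0"
      unfolding M.dependent_explicit by blast
    \<comment> \<open>Coefficients indexed by the elements of t are moved to exponents, with 0 for
      powers outside t.\<close>
    define c where "c = (\<lambda>i. if \<theta> 1 ^ i \<in> t then u (\<theta> 1 ^ i) else 0)"
    have "(\<Sum>i<?n. of_int (c i) * \<theta> 1 ^ i) = (\<Sum>i<?n. (if \<theta> 1 ^ i \<in> t then of_int (u (\<theta> 1 ^ i)) * \<theta> 1 ^ i else 0))"
      by (intro sum.cong) (auto simp: c_def)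
    also have "\<dots> = (\<Sum>v\<in>?B. (if v \<in> t then of_int (u v) * v else 0))"
      unfolding B by (simp add: sum.reindex[OF inj])
    also have "\<dots> = (\<Sum>v\<in>?B \<inter> t. of_int (u v) * v)"
      by (subst sum.inter_restrict) (auto simp: B)
    also have "?B \<inter> t = t" using t(2) by blast
    finally have 0: "(\<Sum>i<?n. of_int (c i) * \<theta> 1 ^ i) = 0" using t(3) by simp
    obtain i where i: "i < ?n" "v = \<theta> 1 ^ i" using t by auto
    then have "c i = 0" using powers_independent[OF 0] by blast
    then show False using t i by (simp add: c_def)
  qed
  moreover have "M.span ?B = Zadj (\<theta> 1)"
  proof
    show "M.span ?B \<subseteq> Zadj (\<theta> 1)"
      by (intro M.span_minimal M.subspaceI) auto
    show "Zadj (\<theta> 1) \<subseteq> M.span ?B"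
    proof
      fix x assume "x \<in> Zadj (\<theta> 1)"
      then obtain h where h: "x = ipoly h (\<theta> 1)" by (rule ZadjE)
      \<comment> \<open>As f is monic, pseudo-division is division with remainder over the
        integers.\<close>
      obtain q r where qr: "pseudo_divmod h f = (q, r)" by (metis surj_pair)
      have "f \<noteq> 0" using f(1) by auto
      from pseudo_divmod[OF this qr] have hqr: "h = f * q + r" "r = 0 \<or> Polynomial.degree r < ?n"
        using f(1,2) by auto
      have "x = ipoly r (\<theta> 1)" using f(3) by (simp add: h hqr(1) hom_distribs)
      also have "\<dots> = (\<Sum>i\<le>Polynomial.degree r. of_int (coeff r i) * \<theta> 1 ^ i)"
        by (simp add: poly_altdef)
      also have "\<dots> = (\<Sum>i<?n. of_int (coeff r i) * \<theta> 1 ^ i)"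
        using hqr(2) card_conjugates_pos
        by (intro sum.mono_neutral_left) (auto simp: coeff_eq_0)
      also have "\<dots> \<in> M.span ?B"
        by (intro M.span_sum M.span_scale M.span_base) auto
      finally show "x \<in> M.span ?B" .
    qed
  qed
  ultimately show ?thesis unfolding Z_basis_def by blast
qed

lemma adjoin_\<theta>: "adjoin {\<theta> 1} = K"
  using Zadj_subset_K by (intro adjoin_eq_K) auto

lemma Z_basis_ring_of_integers:
  assumes "lead_coeff f = 1" "2 * Polynomial.degree f = totient d" "ipoly f (\<theta> 1) = 0"
  shows "Z_basis {\<theta> 1 ^ i | i. i < Polynomial.degree f} (ring_of_integers (adjoin {\<theta> 1}))"
proof -
  have "Polynomial.degree f = card conjugates" using assms(2) card_conjugates by simp
  then show ?thesis
    using Z_basis_powers[of f] assms by (simp add: ring_of_integers_def adjoin_\<theta> ring_of_integers_K)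
qed

end

text \<open>An integral form f of \<open>Omega d\<close> is assumed here;
  \<open>Omega_integral\<close> provides it and \<open>omega_poly_exists\<close> a matching
  \<open>\<eta>\<close>.\<close>

locale omega_poly = odd_unity_root +
  fixes f :: "int poly"
  assumes f_eq: "map_poly of_int f = (\<Prod>s\<in>conjugates. [:- s, 1:])"
begin

lemma degree_f: "Polynomial.degree f = card conjugates"
proof -
  have "Polynomial.degree f = Polynomial.degree (map_poly of_int f :: complex poly)" by simp
  also have "\<dots> = card conjugates"
    unfolding f_eq by (subst degree_prod_eq_sum_degree) auto
  finally show ?thesis .
qed

lemma lead_coeff_f: "lead_coeff f = 1"
proof -
  have "of_int (lead_coeff f) = lead_coeff (map_poly of_int f :: complex poly)" by simp
  also have "\<dots> = 1" unfolding f_eq by (simp add: lead_coeff_prod)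
  finally show ?thesis by simp
qed

lemma roots_f: "complex_roots f = conjugates"
  unfolding f_eq by (auto simp: poly_prod)

lemma irreducible_f: "irreducible_over_Q f"
proof (rule irreducible_if_root[OF lead_coeff_f degree_f])
  have "\<theta> 1 \<in> complex_roots f" unfolding roots_f conjugates_def by auto
  then show "ipoly f (\<theta> 1) = 0" by simp
qed

lemma monogenic_f: "monogenic f"
  unfolding monogenic_def
proof (intro conjI ballI lead_coeff_f irreducible_f)
  fix z assume z: "z \<in> complex_roots f"
  then obtain a where a: "coprime a d" "z = \<theta> a" unfolding roots_f by (auto simp: conjugates_def)
  \<comment> \<open>Taking \<open>\<eta> ^ a\<close> as the root of unity turns the root z into the
    base element \<open>\<theta> 1\<close> of this interpretation.\<close>
  interpret a: odd_unity_root "\<eta> ^ a" d by (rule conjugate_odd[OF a(1)])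
  have eq: "z = a.\<theta> 1" by (simp add: a \<theta>_def a.\<theta>_def)
  show "Z_basis {z ^ i | i. i < Polynomial.degree f} (ring_of_integers (adjoin {z}))"
    unfolding eq using z
    by (intro a.Z_basis_ring_of_integers lead_coeff_f) (simp_all add: degree_f card_conjugates eq)
qed

end

section \<open>The Galois group\<close>

text \<open>Powers of x depend only on the exponent modulo the group order, so exponents below it
  reach all of G; counting makes this surjection injective.\<close>

lemma (in group) iso_integer_mod_group_if_powers:
  assumes fin: "finite (carrier G)" and x: "x \<in> carrier G"
    and gen: "\<And>y. y \<in> carrier G \<Longrightarrow> \<exists>k::nat. y = x [^] k"
  shows "G \<cong> integer_mod_group (Coset.order G)"
proof -
  define N where "N = Coset.order G"
  have N: "N > 0" using fin x by (auto simp: N_def Coset.order_def card_gt_0_iff)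
  have xN: "x [^] N = \<one>" unfolding N_def using x by (rule pow_order_eq_1)
  have mod: "x [^] (k mod N) = x [^] k" for k :: nat
  proof -
    have "x [^] k = x [^] (N * (k div N) + k mod N)" by simp
    also have "\<dots> = (x [^] N) [^] (k div N) \<otimes> x [^] (k mod N)"
      using x by (simp only: nat_pow_mult nat_pow_pow nat_pow_closed)
    finally show ?thesis using x by (simp add: xN)
  qed
  define h where "h = (\<lambda>i::int. x [^] nat i)"
  have surj: "h ` {0..<int N} = carrier G"
  proof (intro equalityI subsetI)
    fix y assume "y \<in> carrier G"
    then obtain k :: nat where "y = x [^] k" using gen by blast
    then have "y = h (int (k mod N))" by (simp add: h_def mod)
    moreover have "int (k mod N) \<in> {0..<int N}" using N by simp
    ultimately show "y \<in> h ` {0..<int N}" by blast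
  qed (use x in \<open>auto simp: h_def\<close>)
  moreover have "inj_on h {0..<int N}"
  proof (rule eq_card_imp_inj_on)
    show "card (h ` {0..<int N}) = card {0..<int N}"
      unfolding surj by (simp add: N_def Coset.order_def)
  qed simp
  ultimately have "bij_betw h {0..<int N} (carrier G)" by (simp add: bij_betw_def)
  moreover have "h ((i + j) mod int N) = h i \<otimes> h j" if "i \<in> {0..<int N}" "j \<in> {0..<int N}" for i j
  proof -
    have "nat ((i + j) mod int N) = (nat i + nat j) mod N"
      using that N by (simp add: nat_mod_distrib nat_add_distrib)
    then show ?thesis using x by (simp add: h_def mod nat_pow_mult)
  qed
  ultimately have "h \<in> iso (integer_mod_group N) G"
    using N by (auto simp: iso_def hom_def carrier_integer_mod_group bij_betw_def)
  then have "integer_mod_group N \<cong> G" by (auto simp: is_iso_def)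
  then show ?thesis unfolding N_def by (rule group.iso_sym[OF group_integer_mod_group])
qed

lemma (in group) powers_if_iso_integer_mod_group:
  assumes "G \<cong> integer_mod_group N" "N > 0"
  obtains x where "x \<in> carrier G" "\<And>y. y \<in> carrier G \<Longrightarrow> \<exists>k::nat. y = x [^] k"
proof -
  obtain h where h: "h \<in> iso G (integer_mod_group N)" using assms(1) by (auto simp: is_iso_def)
  have bij: "bij_betw h (carrier G) {0..<int N}"
    using h assms(2) by (auto simp: iso_def carrier_integer_mod_group)
  \<comment> \<open>The form \<open>1 mod int N\<close> also covers N = 1, where 0 is the only
    element.\<close>
  have "1 mod int N \<in> {0..<int N}" using assms(2) by simp
  then obtain x where x: "x \<in> carrier G" "h x = 1 mod int N"
    using bij by (metis bij_betw_imp_surj_on imageE)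
  interpret hom: group_hom G "integer_mod_group N" h
    using h by (intro group_hom.intro group_hom_axioms.intro is_group group_integer_mod_group)
      (simp add: iso_def)
  have "\<exists>k::nat. y = x [^] k" if y: "y \<in> carrier G" for y
  proof
    have hy: "h y \<in> {0..<int N}" using bij y by (metis bij_betw_apply)
    have "h (x [^] nat (h y)) = h x [^]\<^bsub>integer_mod_group N\<^esub> nat (h y)"
      using x(1) by (rule hom.hom_nat_pow)
    also have "\<dots> = h y" using hy x(2) by (simp add: mod_mult_right_eq)
    finally show "y = x [^] nat (h y)"
      using bij x(1) y by (metis bij_betw_imp_inj_on inj_on_def nat_pow_closed)
  qed
  with x(1) show ?thesis by (rule that)
qed

section \<open>Automorphisms of K\<close>

context omega_poly
begin

text \<open>Substitution of \<open>\<theta> a\<close> for \<open>\<theta> 1\<close> in a chosen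
  polynomial; \<open>aut_rpoly\<close> shows that the choice is immaterial for a coprime to d. The
  restriction to K follows the convention of \<open>Bij\<close>.\<close>

definition aut :: "nat \<Rightarrow> complex \<Rightarrow> complex" where
  "aut a = (\<lambda>x\<in>K. rpoly (SOME h. x = rpoly h (\<theta> 1)) (\<theta> a))"

lemma aut_rpoly:
  assumes "coprime a d"
  shows "aut a (rpoly h (\<theta> 1)) = rpoly h (\<theta> a)"
proof -
  define h' where "h' = (SOME h'. rpoly h (\<theta> 1) = rpoly h' (\<theta> 1))"
  have "rpoly h (\<theta> 1) = rpoly h' (\<theta> 1)" unfolding h'_def by (rule someI) simp
  then have "rpoly h' (\<theta> a) = rpoly h (\<theta> (a * 1))"
    using assms by (intro rpoly_\<theta>_transfer) auto
  then show ?thesis by (simp add: aut_def h'_def)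
qed

lemma \<theta>_in_K [simp]: "\<theta> a \<in> K"
  using \<theta>_in_Zadj Zadj_subset_K by blast

lemma KE:
  assumes "x \<in> K"
  obtains h where "x = rpoly h (\<theta> 1)"
  using assms by (auto simp: K_def)

lemma rpoly_K_closed: "x \<in> K \<Longrightarrow> rpoly h x \<in> K"
proof (induction h)
  case (pCons c h)
  have "of_rat c \<in> K" using Rats_subset_K by auto
  with pCons show ?case by (simp add: hom_distribs K_closed)
qed (use Rats_subset_K in auto)

lemma aut_\<theta>:
  assumes "coprime a d"
  shows "aut a (\<theta> b) = \<theta> (a * b)"
proof -
  obtain g where g: "\<theta> b = rpoly g (\<theta> 1)" using \<theta>_in_K[of b] by (rule KE)
  have "rpoly g (\<theta> 1) = rpoly [:0, 1:] (\<theta> b)" by (simp add: g hom_distribs)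
  then have "rpoly g (\<theta> a) = rpoly [:0, 1:] (\<theta> (a * b))" using assms by (rule rpoly_\<theta>_transfer)
  then show ?thesis using aut_rpoly[OF assms, of g] by (simp add: g hom_distribs)
qed

lemma rpoly_pcompose: "rpoly (pcompose g h) z = rpoly g (rpoly h z)"
  by (induction g) (simp_all add: pcompose_pCons hom_distribs)

lemma aut_closed: "coprime a d \<Longrightarrow> x \<in> K \<Longrightarrow> aut a x \<in> K"
  by (elim KE) (simp add: aut_rpoly rpoly_K_closed)

lemma aut_aut:
  assumes "coprime a d" "coprime b d" "x \<in> K"
  shows "aut a (aut b x) = aut (a * b) x"
proof -
  obtain h where h: "x = rpoly h (\<theta> 1)" using assms(3) by (rule KE)
  obtain g where g: "\<theta> b = rpoly g (\<theta> 1)" using \<theta>_in_K[of b] by (rule KE)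
  have "aut a (aut b x) = aut a (rpoly (pcompose h g) (\<theta> 1))"
    using assms(2) by (simp add: h aut_rpoly rpoly_pcompose g)
  also have "\<dots> = rpoly h (rpoly g (\<theta> a))"
    unfolding aut_rpoly[OF assms(1)] by (rule rpoly_pcompose)
  also have "rpoly g (\<theta> a) = \<theta> (a * b)"
    using aut_\<theta>[OF assms(1), of b] assms(1) by (simp add: aut_rpoly g)
  also have "rpoly h (\<theta> (a * b)) = aut (a * b) x"
    using assms by (simp add: h aut_rpoly)
  finally show ?thesis .
qed

lemma aut_eq_iff:
  assumes "coprime a d" "coprime b d"
  shows "aut a = aut b \<longleftrightarrow> \<theta> a = \<theta> b"
proof
  assume "aut a = aut b"
  then show "\<theta> a = \<theta> b" using aut_\<theta>[OF assms(1), of 1] aut_\<theta>[OF assms(2), of 1] by simp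
next
  assume eq: "\<theta> a = \<theta> b"
  show "aut a = aut b"
  proof
    fix x show "aut a x = aut b x"
    proof (cases "x \<in> K")
      case True
      then show ?thesis using assms eq by (elim KE) (simp add: aut_rpoly)
    qed (simp add: aut_def)
  qed
qed

lemma aut_1: "aut 1 = (\<lambda>x\<in>K. x)"
proof
  fix x show "aut 1 x = (\<lambda>x\<in>K. x) x"
  proof (cases "x \<in> K")
    case True
    then show ?thesis by (elim KE) (simp add: aut_rpoly)
  qed (simp add: aut_def)
qed

lemma aut_inverse:
  assumes "coprime a d"
  obtains b where "coprime b d" "aut (a * b) = aut 1" "aut (b * a) = aut 1"
proof -
  obtain b where b: "[a * b = 1] (mod d)" using cong_solve_coprime_nat[OF assms] unfolding One_nat_def by blast
  then have "coprime (a * b) d" using cong_imp_coprime[of 1 "a * b" d] by (simp add: cong_sym_eq)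
  then have "coprime b d" by simp
  moreover have "\<theta> (a * b) = \<theta> 1" using b by (simp add: \<theta>_eq_iff)
  ultimately show ?thesis using assms by (intro that[of b]) (simp_all add: aut_eq_iff mult.commute)
qed

lemma aut_in_Bij:
  assumes "coprime a d"
  shows "aut a \<in> Bij K"
proof -
  obtain b where b: "coprime b d" "aut (a * b) = aut 1" "aut (b * a) = aut 1"
    using assms by (rule aut_inverse)
  have "bij_betw (aut a) K K"
    using assms b by (intro bij_betw_byWitness[where f' = "aut b"])
      (auto simp: aut_aut aut_closed aut_1)
  then show ?thesis by (simp add: Bij_def aut_def)
qed

abbreviation KR :: "complex ring" where
  "KR \<equiv> ring_of_type_algebra\<lparr>carrier := K\<rparr>"

lemma KR_simps [simp]:
  "carrier KR = K" "monoid.mult KR = (*)" "ring.add KR = (+)" "\<one>\<^bsub>KR\<^esub> = 1"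
  by (simp_all add: ring_of_type_algebra_def)

lemma aut_rat:
  assumes "coprime a d" "x \<in> \<rat>"
  shows "aut a x = x"
proof -
  obtain q where "x = of_rat q" using assms(2) by (rule Rats_cases)
  then have "x = rpoly [:q:] (\<theta> b)" for b by (simp add: hom_distribs)
  then show ?thesis using aut_rpoly[OF assms(1)] by metis
qed

lemma aut_in_ring_hom:
  assumes "coprime a d"
  shows "aut a \<in> Ring.ring_hom KR KR"
proof (rule ring_hom_memI)
  fix x y assume "x \<in> carrier KR" "y \<in> carrier KR"
  then obtain g h where gh: "x = rpoly g (\<theta> 1)" "y = rpoly h (\<theta> 1)" by (metis KE KR_simps(1))
  have "x * y = rpoly (g * h) (\<theta> 1)" "x + y = rpoly (g + h) (\<theta> 1)"
    by (simp_all add: gh hom_distribs)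
  then show "aut a (x \<otimes>\<^bsub>KR\<^esub> y) = aut a x \<otimes>\<^bsub>KR\<^esub> aut a y"
    "aut a (x \<oplus>\<^bsub>KR\<^esub> y) = aut a x \<oplus>\<^bsub>KR\<^esub> aut a y"
    using aut_rpoly[OF assms, of "g * h"] aut_rpoly[OF assms, of "g + h"] assms
    by (simp_all add: aut_rpoly gh hom_distribs)
qed (use assms aut_closed aut_rat[OF assms, of 1] in auto)

lemma Gal_f: "Gal f = (BijGroup K)\<lparr>carrier := {\<sigma> \<in> Bij K. \<sigma> \<in> Ring.ring_hom KR KR \<and> (\<forall>x\<in>\<rat>. \<sigma> x = x)}\<rparr>"
proof -
  have "adjoin (complex_roots f) = K"
    unfolding roots_f by (rule adjoin_eq_K) (auto simp: conjugates_def)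
  then show ?thesis by (simp add: Gal_def Let_def)
qed

text \<open>Such a map commutes with rational polynomials, so it is determined by its value at
  \<open>\<theta> 1\<close>, which is again a root of f.\<close>

lemma automorphism_eq_aut:
  assumes \<sigma>: "\<sigma> \<in> Bij K" "\<sigma> \<in> Ring.ring_hom KR KR" "\<forall>x\<in>\<rat>. \<sigma> x = x"
  shows "\<exists>a. coprime a d \<and> \<sigma> = aut a"
proof -
  have add: "\<sigma> (x + y) = \<sigma> x + \<sigma> y" and mult: "\<sigma> (x * y) = \<sigma> x * \<sigma> y" if "x \<in> K" "y \<in> K" for x y
    using ring_hom_add[OF \<sigma>(2), of x y] ring_hom_mult[OF \<sigma>(2), of x y] that by simp_all
  have rpoly: "\<sigma> (rpoly h (\<theta> 1)) = rpoly h (\<sigma> (\<theta> 1))" for h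
  proof (induction h)
    case 0
    then show ?case using \<sigma>(3) by simp
  next
    case (pCons c h)
    have "of_rat c \<in> K" using Rats_subset_K by auto
    then show ?case
      using pCons.IH \<sigma>(3) rpoly_in_K[of h] \<theta>_in_K[of 1]
      by (simp add: hom_distribs add mult K_closed del: rpoly_in_K \<theta>_in_K)
  qed
  have "ipoly f (\<sigma> (\<theta> 1)) = \<sigma> (ipoly f (\<theta> 1))"
    using rpoly[of "map_poly of_int f"] by (simp add: ipoly_conv_rpoly)
  also have "\<theta> 1 \<in> complex_roots f" unfolding roots_f conjugates_def by auto
  then have "ipoly f (\<theta> 1) = 0" by simp
  also have "\<sigma> 0 = 0" using \<sigma>(3) by simp
  finally have "\<sigma> (\<theta> 1) \<in> conjugates" using roots_f by blast
  then obtain a where a: "coprime a d" "\<sigma> (\<theta> 1) = \<theta> a" by (auto simp: conjugates_def)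
  have "\<sigma> x = aut a x" for x
  proof (cases "x \<in> K")
    case True
    then obtain h where "x = rpoly h (\<theta> 1)" by (rule KE)
    then show ?thesis by (simp add: rpoly a aut_rpoly)
  next
    case False
    then show ?thesis using \<sigma>(1) by (auto simp: Bij_def extensional_def aut_def)
  qed
  with a(1) show ?thesis by blast
qed

lemma carrier_Gal: "carrier (Gal f) = aut ` {a. coprime a d}"
  using aut_in_Bij aut_in_ring_hom aut_rat by (auto simp: Gal_f dest!: automorphism_eq_aut)

lemma mult_Gal:
  assumes "coprime a d" "coprime b d"
  shows "aut a \<otimes>\<^bsub>Gal f\<^esub> aut b = aut (a * b)"
proof -
  have "aut a \<otimes>\<^bsub>Gal f\<^esub> aut b = compose K (aut a) (aut b)"
    using assms by (simp add: Gal_f BijGroup_def aut_in_Bij)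
  also have "\<dots> = aut (a * b)"
    using assms by (auto simp: compose_def aut_aut fun_eq_iff) (simp add: aut_def)
  finally show ?thesis .
qed

lemma one_Gal: "\<one>\<^bsub>Gal f\<^esub> = aut 1"
  by (simp add: Gal_f BijGroup_def aut_1)

lemma group_Gal: "group (Gal f)"
proof (rule groupI)
  fix x assume "x \<in> carrier (Gal f)"
  then obtain a where a: "coprime a d" "x = aut a" by (auto simp: carrier_Gal)
  from a(1) obtain b where "coprime b d" "aut (b * a) = aut 1" by (rule aut_inverse)
  then show "\<exists>y\<in>carrier (Gal f). y \<otimes>\<^bsub>Gal f\<^esub> x = \<one>\<^bsub>Gal f\<^esub>"
    using a by (intro bexI[of _ "aut b"]) (auto simp: carrier_Gal mult_Gal one_Gal)
qed (auto simp: carrier_Gal mult_Gal one_Gal mult.assoc)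

text \<open>Evaluation at \<open>\<theta> 1\<close> identifies the automorphisms with the
  conjugates.\<close>

lemma order_Gal: "Coset.order (Gal f) = card conjugates"
proof -
  have "bij_betw (\<lambda>\<sigma>. \<sigma> (\<theta> 1)) (carrier (Gal f)) conjugates"
    unfolding bij_betw_def carrier_Gal conjugates_def
    by (auto simp: inj_on_def aut_\<theta> aut_eq_iff image_image)
  then show ?thesis unfolding Coset.order_def by (rule bij_betw_same_card)
qed

lemma pow_Gal: "coprime g d \<Longrightarrow> aut g [^]\<^bsub>Gal f\<^esub> k = aut (g ^ k)"
proof (induction k)
  case 0
  then show ?case using one_Gal by simp
next
  case (Suc k)
  then show ?case by (simp add: mult_Gal mult.commute)
qed

text \<open>Two maps \<open>aut a\<close> and \<open>aut b\<close> agree exactly when a and b agree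
  modulo d up to sign, so generators correspond on both sides.\<close>

theorem Gal_cyclic_iff:
  "Gal f \<cong> integer_mod_group (card conjugates) \<longleftrightarrow>
     (\<exists>g. coprime g d \<and> (\<forall>a. coprime a d \<longrightarrow> (\<exists>k. [a = g ^ k] (mod d) \<or> d dvd a + g ^ k)))"
proof -
  interpret G: group "Gal f" by (rule group_Gal)
  have *: "aut a = aut g [^]\<^bsub>Gal f\<^esub> k \<longleftrightarrow> [a = g ^ k] (mod d) \<or> d dvd a + g ^ k"
    if "coprime a d" "coprime g d" for a g k
    using that by (simp add: pow_Gal aut_eq_iff \<theta>_eq_iff)
  show ?thesis
  proof
    assume "Gal f \<cong> integer_mod_group (card conjugates)"
    then obtain x where x: "x \<in> carrier (Gal f)" "\<And>y. y \<in> carrier (Gal f) \<Longrightarrow> \<exists>k::nat. y = x [^]\<^bsub>Gal f\<^esub> k"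
      using G.powers_if_iso_integer_mod_group card_conjugates_pos by metis
    obtain g where g: "coprime g d" "x = aut g" using x(1) by (auto simp: carrier_Gal)
    have "\<exists>k. [a = g ^ k] (mod d) \<or> d dvd a + g ^ k" if "coprime a d" for a
      using x(2)[of "aut a"] that g * by (auto simp: carrier_Gal)
    with g(1) show "\<exists>g. coprime g d \<and> (\<forall>a. coprime a d \<longrightarrow> (\<exists>k. [a = g ^ k] (mod d) \<or> d dvd a + g ^ k))"
      by blast
  next
    assume "\<exists>g. coprime g d \<and> (\<forall>a. coprime a d \<longrightarrow> (\<exists>k. [a = g ^ k] (mod d) \<or> d dvd a + g ^ k))"
    then obtain g where g: "coprime g d"
      "\<And>a. coprime a d \<Longrightarrow> \<exists>k. [a = g ^ k] (mod d) \<or> d dvd a + g ^ k" by blast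
    have "finite (carrier (Gal f))"
      using order_Gal card_conjugates_pos by (auto simp: Coset.order_def intro: card_ge_0_finite)
    then have "Gal f \<cong> integer_mod_group (Coset.order (Gal f))"
    proof (rule G.iso_integer_mod_group_if_powers)
      show "aut g \<in> carrier (Gal f)" using g(1) by (auto simp: carrier_Gal)
      show "\<exists>k::nat. y = aut g [^]\<^bsub>Gal f\<^esub> k" if "y \<in> carrier (Gal f)" for y
        using that g * by (auto simp: carrier_Gal)
    qed
    then show "Gal f \<cong> integer_mod_group (card conjugates)" by (simp add: order_Gal)
  qed
qed

end

section \<open>The polynomials w and Omega\<close>

declare One_nat_def [simp]

definition omega_root :: "nat \<Rightarrow> nat \<Rightarrow> complex" where
  "omega_root m d = exp (\<i> * of_real pi * of_nat m / of_nat d)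
     + exp (- (\<i> * of_real pi * of_nat m / of_nat d)) + 2"

lemma omega_root_cis: "omega_root m d = cis (pi * m / d) + inverse (cis (pi * m / d)) + 2"
  by (simp add: omega_root_def cis_conv_exp exp_minus mult_ac)

lemma omega_root_cos: "omega_root m d = of_real (2 * cos (pi * m / d) + 2)"
  by (simp add: omega_root_cis cis_inverse complex_eq_iff)

lemma Omega_eq: "Omega d = (\<Prod>m | 1 \<le> m \<and> m < d \<and> odd m \<and> coprime m d. [:- omega_root m d, 1:])"
  unfolding Omega_def omega_root_def by (intro prod.cong) auto

lemma omega_root_inj:
  assumes "omega_root m d = omega_root m' d" "m \<le> d" "m' \<le> d" "d > 0"
  shows "m = m'"
proof -
  have "cos (pi * m / d) = cos (pi * m' / d)"
    using assms(1) unfolding omega_root_cos of_real_eq_iff by linarith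
  moreover have "0 \<le> pi * k / d" "pi * k / d \<le> pi" if "k \<le> d" for k :: nat
  proof -
    have "pi * k \<le> pi * d" using that by (intro mult_left_mono) auto
    then show "pi * k / d \<le> pi" using assms(4) by (intro divide_le_eq[THEN iffD2]) auto
  qed auto
  ultimately have "pi * m / d = pi * m' / d"
    using assms(2,3) cos_inj_pi by blast
  then show ?thesis using assms(4) by simp
qed

text \<open>At \<open>\<zeta> + inverse \<zeta> + 2\<close> the recurrence has characteristic roots
  \<open>\<zeta>\<close> and \<open>inverse \<zeta>\<close>. This is its closed form, multiplied out
  to avoid division and negative exponents.\<close>

lemma w_identity:
  assumes "\<zeta> \<noteq> 0"
  shows "\<zeta> ^ n * (\<zeta> + 1) * ipoly (w n) (\<zeta> + inverse \<zeta> + 2) = \<zeta> ^ (2 * n) + \<zeta>"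
proof (induction n rule: w.induct)
  case (3 n)
  let ?x = "\<zeta> + inverse \<zeta> + 2"
  have eq: "ipoly (w (Suc (Suc n))) ?x = (?x - 2) * ipoly (w (Suc n)) ?x - ipoly (w n) ?x"
    by (simp add: hom_distribs)
  have "\<zeta> ^ Suc (Suc n) * (\<zeta> + 1) * ipoly (w (Suc (Suc n))) ?x =
      (\<zeta> * (\<zeta> + inverse \<zeta>)) * (\<zeta> ^ Suc n * (\<zeta> + 1) * ipoly (w (Suc n)) ?x)
      - \<zeta> * \<zeta> * (\<zeta> ^ n * (\<zeta> + 1) * ipoly (w n) ?x)"
    unfolding eq by (simp add: algebra_simps del: w.simps)
  also have "\<zeta> * (\<zeta> + inverse \<zeta>) = \<zeta> * \<zeta> + 1" using assms by (simp add: distrib_left)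
  finally show ?case unfolding 3 by (simp add: algebra_simps power_add power2_eq_square)
qed (simp_all add: power2_eq_square algebra_simps)

text \<open>Two consecutive terms are carried through the induction; at n = 0 truncated subtraction
  makes \<open>n - 1\<close> the correct bound 0.\<close>

lemma w_degree: "Polynomial.degree (w n) \<le> n - 1 \<and> Polynomial.degree (w (Suc n)) = n \<and> coeff (w (Suc n)) n = 1"
proof (induction n)
  case (Suc n)
  have eq: "w (Suc (Suc n)) = [:-2, 1:] * w (Suc n) - w n"
    by (simp add: numeral_poly)
  have nz: "w (Suc n) \<noteq> 0" using Suc by auto
  have deg: "Polynomial.degree ([:-2, 1:] * w (Suc n)) = Suc n"
    using Suc nz by (subst degree_mult_eq) auto
  then have "Polynomial.degree (- w n) < Polynomial.degree ([:-2, 1:] * w (Suc n))" using Suc by auto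
  then have d: "Polynomial.degree (w (Suc (Suc n))) = Suc n"
    unfolding eq diff_conv_add_uminus using deg degree_add_eq_left by metis
  have "coeff (w n) (Suc n) = 0" "coeff (w (Suc n)) (Suc n) = 0"
    using Suc by (auto intro: coeff_eq_0)
  then have "coeff (w (Suc (Suc n))) (Suc n) = 1" unfolding eq using Suc by simp
  with d show ?case using Suc by simp
qed auto

text \<open>For odd m below N = 2n - 1, \<open>\<zeta> = cis (pi * m / N)\<close> satisfies
  \<open>\<zeta> ^ N = -1\<close>, so the right side of \<open>w_identity\<close> vanishes while
  \<open>\<zeta> + 1\<close> does not. These n - 1 distinct roots exhaust the degree.\<close>

lemma w_eq_prod:
  assumes "n \<ge> 2"
  shows "map_poly of_int (w n) = (\<Prod>m | m < 2 * n - 1 \<and> odd m. [:- omega_root m (2 * n - 1), 1:])"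
proof -
  let ?N = "2 * n - 1" and ?M = "{m. m < 2 * n - 1 \<and> odd m}"
  obtain k where k: "n = Suc k" "k \<ge> 1" using assms by (cases n) auto
  have fin: "finite ?M" by simp
  have inj: "inj_on (\<lambda>m. omega_root m ?N) ?M"
    using assms by (auto intro!: inj_onI dest: omega_root_inj)
  have "?M = (\<lambda>i. 2 * i + 1) ` {..<k}"
    using k by (auto elim!: oddE)
  then have card: "card ?M = k" by (simp add: card_image inj_on_def)
  have "map_poly of_int (w n) = (\<Prod>s\<in>(\<lambda>m. omega_root m ?N) ` ?M. [:- s, 1:])"
  proof (rule monic_eq_prod_roots)
    show "lead_coeff (map_poly complex_of_int (w n)) = 1" using w_degree[of k] k by simp
    show "card ((\<lambda>m. omega_root m ?N) ` ?M) = Polynomial.degree (map_poly complex_of_int (w n))"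
      using w_degree[of k] k card card_image[OF inj] by simp
    fix s assume "s \<in> (\<lambda>m. omega_root m ?N) ` ?M"
    then obtain m where m: "m < ?N" "odd m" "s = omega_root m ?N" by auto
    define \<zeta> where "\<zeta> = cis (pi * m / ?N)"
    have s: "s = \<zeta> + inverse \<zeta> + 2" unfolding m(3) omega_root_cis \<zeta>_def ..
    have "\<zeta> ^ ?N = cis (real ?N * (pi * m / ?N))" by (simp only: \<zeta>_def DeMoivre)
    also have "real ?N * (pi * m / ?N) = real m * pi" using m(1) by simp
    also have "cis (real m * pi) = (-1) ^ m" by (simp flip: DeMoivre)
    finally have "\<zeta> ^ ?N = -1" using m(2) by simp
    moreover have "\<zeta> ^ (2 * n) = \<zeta> * \<zeta> ^ ?N"
      using assms by (simp flip: power_Suc)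
    ultimately have 0: "\<zeta> ^ (2 * n) + \<zeta> = 0" by simp
    have nz: "\<zeta> \<noteq> 0" by (simp add: \<zeta>_def)
    have "\<zeta> \<noteq> -1"
    proof
      assume "\<zeta> = -1"
      \<comment> \<open>The value -1 belongs to the endpoint m = N, which
        \<open>omega_root_inj\<close> includes but the index set excludes.\<close>
      then have "s = omega_root ?N ?N" using assms by (simp add: s omega_root_cis)
      then have "m = ?N" using m assms by (intro omega_root_inj[of m ?N]) auto
      then show False using m(1) by simp
    qed
    then have "\<zeta> + 1 \<noteq> 0" by (simp add: add_eq_0_iff2)
    then show "ipoly (w n) s = 0"
      using w_identity[OF nz, of n] nz unfolding 0 s by simp
  qed (use fin in simp)
  then show ?thesis by (simp only: prod.reindex[OF inj] o_def)
qed

text \<open>Each odd \<open>m < N\<close> is grouped by the denominator \<open>d\<close> of the reduced fraction \<open>m/N\<close>.\<close>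

lemma w_eq_prod_Omega:
  assumes "n \<ge> 2"
  shows "map_poly of_int (w n) = (\<Prod>d | d dvd 2 * n - 1 \<and> d > 1. Omega d)"
proof -
  define N where "N = 2 * n - 1"
  have N: "odd N" "N > 1" using assms by (auto simp: N_def)
  define D where "D = {d. d dvd N \<and> d > 1}"
  define I where "I = (\<lambda>d. {m. 1 \<le> m \<and> m < d \<and> odd m \<and> coprime m (d::nat)})"
  have fin: "finite D" "finite (I d)" for d
    using N by (auto simp: D_def I_def intro: finite_subset[OF _ finite_divisors_nat[of N]])
  have "(\<Prod>d\<in>D. Omega d) = (\<Prod>d\<in>D. \<Prod>m\<in>I d. [:- omega_root m d, 1:])"
    by (simp add: Omega_eq I_def)
  also have "\<dots> = (\<Prod>(d, m)\<in>Sigma D I. [:- omega_root m d, 1:])"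
    using fin by (intro prod.Sigma) auto
  also have "\<dots> = (\<Prod>m | m < N \<and> odd m. [:- omega_root m N, 1:])"
  proof (rule prod.reindex_bij_witness
      [where i = "\<lambda>m. (N div gcd m N, m div gcd m N)" and j = "\<lambda>(d, m). m * (N div d)"])
    fix x assume "x \<in> Sigma D I"
    then obtain d m where x: "x = (d, m)" "d dvd N" "d > 1" "1 \<le> m" "m < d" "odd m" "coprime m d"
      by (auto simp: D_def I_def)
    then obtain e where e: "N = d * e" by blast
    have e0: "e > 0" using N e by (auto intro: Nat.gr0I)
    have quot: "N div d = e" "N div e = d" using e x e0 by simp_all
    have gcd: "gcd (m * e) N = e"
      unfolding e using x(7) by (metis coprime_iff_gcd_eq_1 gcd_mult_distrib_nat mult.commute mult.right_neutral)
    show "(\<lambda>m. (N div gcd m N, m div gcd m N)) ((\<lambda>(d, m). m * (N div d)) x) = x"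
    proof -
      have "(N div gcd (m * e) N, m * e div gcd (m * e) N) = (d, m)"
        unfolding gcd using quot e0 by simp
      then show ?thesis by (simp only: x(1) prod.case quot(1))
    qed
    show "(\<lambda>(d, m). m * (N div d)) x \<in> {m. m < N \<and> odd m}"
      using e0 x N by (simp add: quot e)
    show "[:- omega_root ((\<lambda>(d, m). m * (N div d)) x) N, 1:] = (case x of (d, m) \<Rightarrow> [:- omega_root m d, 1:])"
      using e0 by (simp add: x(1) quot) (simp add: e omega_root_cos)
  next
    fix m assume "m \<in> {m. m < N \<and> odd m}"
    then have m: "m < N" "odd m" by auto
    define e where "e = gcd m N"
    have "m > 0" using m by (auto intro: Nat.gr0I)
    then have e0: "e > 0" by (simp add: e_def)
    obtain m' d where md: "m = m' * e" "N = d * e" "coprime m' d"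
      using gcd_coprime_exists[of m N] e0 unfolding e_def by auto
    have q: "m div e = m'" "N div e = d" using md e0 by simp_all
    have d0: "d > 0" using md N by (auto intro: Nat.gr0I)
    have m'd: "m' < d" using m md e0 by simp
    have "odd m'" using m md by simp
    then have m'0: "m' > 0" by (auto intro: Nat.gr0I)
    show "(\<lambda>(d, m). m * (N div d)) (N div gcd m N, m div gcd m N) = m"
      using d0 by (simp add: q flip: e_def) (simp add: md)
    show "(N div gcd m N, m div gcd m N) \<in> Sigma D I"
    proof -
      have "(N div gcd m N, m div gcd m N) = (d, m')" by (simp add: q flip: e_def)
      moreover have "d dvd N" "d > 1" using md m'd m'0 by auto
      ultimately show ?thesis using m'd m'0 \<open>odd m'\<close> md(3) by (simp add: D_def I_def)
    qed
  qed
  also have "\<dots> = map_poly of_int (w n)" using w_eq_prod[OF assms] by (simp add: N_def)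
  finally show ?thesis by (simp add: D_def N_def)
qed

section \<open>Integrality of Omega\<close>

lemma lead_coeff_Omega: "lead_coeff (Omega d) = 1"
  unfolding Omega_eq by (simp add: lead_coeff_prod)

text \<open>Division by the monic G stays over the integers; the remainder is a complex multiple of
  G of too small a degree, hence zero.\<close>

lemma int_poly_quotient:
  fixes P G :: "int poly" and H :: "complex poly"
  assumes "map_poly of_int P = map_poly of_int G * H" "lead_coeff G = 1"
  shows "\<exists>Q. map_poly of_int Q = H"
proof -
  obtain q r where qr: "pseudo_divmod P G = (q, r)" by (metis surj_pair)
  have G0: "G \<noteq> 0" using assms(2) by auto
  from pseudo_divmod[OF G0 qr] have PG: "P = G * q + r" "r = 0 \<or> Polynomial.degree r < Polynomial.degree G"
    using assms(2) by auto
  have eq: "map_poly of_int r = map_poly of_int G * (H - map_poly of_int q)"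
    using assms(1) unfolding PG(1) by (simp add: hom_distribs algebra_simps)
  have "H - map_poly of_int q = 0"
  proof (rule ccontr)
    assume nz: "H - map_poly of_int q \<noteq> 0"
    have "r \<noteq> 0" using eq nz G0 by auto
    have "Polynomial.degree r = Polynomial.degree (map_poly of_int r :: complex poly)" by simp
    also have "\<dots> = Polynomial.degree G + Polynomial.degree (H - map_poly of_int q)"
      unfolding eq using nz G0 by (subst degree_mult_eq) auto
    finally show False using PG(2) \<open>r \<noteq> 0\<close> by simp
  qed
  then show ?thesis by (intro exI[of _ q]) simp
qed

text \<open>By strong induction, \<open>Omega d\<close> is the quotient of \<open>w n\<close>, where
  \<open>2 * n - 1 = d\<close>, by the monic integral product of \<open>Omega d'\<close> over the
  divisors d' with 1 < d' < d.\<close>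

lemma Omega_integral:
  assumes "odd d" "d > 1"
  shows "\<exists>f :: int poly. map_poly of_int f = Omega d"
  using assms
proof (induction d rule: less_induct)
  case (less d)
  define n where "n = (d + 1) div 2"
  have n: "n \<ge> 2" "2 * n - 1 = d" using less.prems by (auto simp: n_def elim!: oddE)
  define D where "D = {d'. d' dvd d \<and> d' > 1 \<and> d' \<noteq> d}"
  have fin: "finite D"
    using less.prems by (auto simp: D_def intro: finite_subset[OF _ finite_divisors_nat[of d]])
  have "\<forall>d'\<in>D. \<exists>f :: int poly. map_poly of_int f = Omega d'"
  proof
    fix d' assume d': "d' \<in> D"
    then have "d' \<le> d" using less.prems by (auto simp: D_def intro: dvd_imp_le)
    moreover have "odd d'" using d' less.prems by (auto simp: D_def)
    ultimately show "\<exists>f :: int poly. map_poly of_int f = Omega d'"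
      using d' by (intro less.IH) (auto simp: D_def)
  qed
  then obtain F :: "nat \<Rightarrow> int poly" where F: "\<And>d'. d' \<in> D \<Longrightarrow> map_poly of_int (F d') = Omega d'"
    by metis
  define G where "G = (\<Prod>d'\<in>D. F d')"
  have G: "map_poly of_int G = (\<Prod>d'\<in>D. Omega d')"
    by (simp add: G_def hom_distribs F)
  have "of_int (lead_coeff G) = lead_coeff (map_poly of_int G :: complex poly)" by simp
  also have "\<dots> = 1" unfolding G by (simp add: lead_coeff_prod lead_coeff_Omega)
  finally have lG: "lead_coeff G = 1" by simp
  have "{d'. d' dvd d \<and> d' > 1} = insert d D" using less.prems by (auto simp: D_def)
  then have "map_poly of_int (w n) = map_poly of_int G * Omega d"
    using w_eq_prod_Omega[OF n(1)] fin unfolding n(2) G by (simp add: D_def mult.commute)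
  then show ?case using lG by (rule int_poly_quotient)
qed

section \<open>Choice of the root of unity and conclusion\<close>

lemma unity_root_cis:
  assumes "d > 0"
  shows "unity_root (cis (2 * pi / d)) d"
proof
  fix k
  let ?\<rho> = "cis (2 * pi / d)"
  have pow: "?\<rho> ^ k = cis (2 * pi * k / d)" for k by (simp add: DeMoivre mult_ac)
  have one: "?\<rho> ^ d = 1" using assms by (simp add: pow)
  have inj: "inj_on (\<lambda>k. cis (2 * pi * real k / real d)) {..<d}"
    using bij_betw_roots_unity[OF assms] by (rule bij_betw_imp_inj_on)
  have "?\<rho> ^ k = ?\<rho> ^ (d * (k div d) + k mod d)" by simp
  also have "\<dots> = ?\<rho> ^ (k mod d)" unfolding power_add power_mult one by simp
  finally have red: "?\<rho> ^ k = ?\<rho> ^ (k mod d)" .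
  show "?\<rho> ^ k = 1 \<longleftrightarrow> d dvd k"
  proof
    assume "?\<rho> ^ k = 1"
    then have "?\<rho> ^ (k mod d) = ?\<rho> ^ 0" using red by simp
    then have "k mod d = 0" unfolding pow using assms by (intro inj_onD[OF inj]) auto
    then show "d dvd k" by auto
  next
    assume "d dvd k"
    then show "?\<rho> ^ k = 1" using red by simp
  qed
qed (fact assms)

lemma omega_poly_exists:
  assumes "odd d" "d > 1" "map_poly of_int f = Omega d"
  shows "\<exists>\<eta>. omega_poly \<eta> d f"
proof -
  \<comment> \<open>Since s inverts 2 modulo d, the s-th power of the standard root is primitive,
    and it equals \<open>- cis (pi / d)\<close>. At odd powers the sign survives, which turns
    \<open>\<theta> m\<close> into \<open>omega_root m d\<close>.\<close>
  define s where "s = (d + 1) div 2"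
  have s: "2 * s = d + 1" using assms(1) by (auto simp: s_def)
  have "coprime s d"
  proof (rule coprimeI)
    fix c assume c: "c dvd s" "c dvd d"
    then have "c dvd d + 1" unfolding s[symmetric] by (rule_tac dvd_mult)
    then show "is_unit c" using c(2) by (simp only: dvd_add_right_iff)
  qed
  define \<eta> where "\<eta> = cis (2 * pi / d) ^ s"
  interpret r: unity_root "cis (2 * pi / d)" d using assms(2) by (intro unity_root_cis) auto
  interpret unity_root \<eta> d unfolding \<eta>_def by (rule r.conjugate) fact
  interpret odd_unity_root \<eta> d using assms(1,2) by unfold_locales
  have \<theta>: "\<theta> m = omega_root m d" if "odd m" for m
  proof -
    have "\<eta> ^ m = cis (2 * pi / d) ^ (s * m)" by (simp only: \<eta>_def power_mult)
    also have "\<dots> = cis (real (s * m) * (2 * pi / d))" by (rule DeMoivre)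
    also have "real (s * m) * (2 * pi / d) = real m * pi + pi * m / d"
    proof -
      have "real (s * m) * (2 * pi / d) = real (2 * s) * (real m * pi / d)" by simp
      also have "\<dots> = real m * pi + pi * m / d" unfolding s using assms(2) by (simp add: field_simps)
      finally show ?thesis .
    qed
    also have "cis \<dots> = (cis pi) ^ m * cis (pi * m / d)" by (simp only: DeMoivre cis_mult)
    finally have "\<eta> ^ m = - cis (pi * m / d)" using that by simp
    then show ?thesis by (simp add: \<theta>_def omega_root_cis)
  qed
  have "omega_poly \<eta> d f"
  proof
    have "map_poly of_int f = (\<Prod>m\<in>odd_totatives. [:- \<theta> m, 1:])"
      unfolding assms(3) Omega_eq odd_totatives_def using \<theta> by (intro prod.cong) auto
    also have "\<dots> = (\<Prod>s\<in>conjugates. [:- s, 1:])"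
      unfolding conjugates_eq_odd by (simp add: prod.reindex[OF inj_on_\<theta>_odd])
    finally show "map_poly of_int f = (\<Prod>s\<in>conjugates. [:- s, 1:])" .
  qed
  then show ?thesis by blast
qed

theorem theorem1p4:
  shows "(\<forall>n\<ge>2. map_poly of_int (w n) = (\<Prod>d | d dvd 2 * n - 1 \<and> d > 1. Omega d)) \<and>
    (\<forall>d::nat. odd d \<and> d > 1 \<longrightarrow>
      (\<exists>f :: int poly. map_poly of_int f = Omega d \<and>
         irreducible_over_Q f \<and> monogenic f \<and>
         Polynomial.degree f = Coset.order (Gal f) \<and>
         real (Coset.order (Gal f)) = real (totient d) / 2 \<and>
         (cyclic_poly f \<and> Gal f \<cong> integer_mod_group (totient d div 2) \<longleftrightarrow> condition_C d)))"
proof (intro conjI allI impI w_eq_prod_Omega)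
  fix d :: nat assume d: "odd d \<and> d > 1"
  then obtain f :: "int poly" where f: "map_poly of_int f = Omega d" using Omega_integral by blast
  then obtain \<eta> where "omega_poly \<eta> d f" using omega_poly_exists d by blast
  then interpret omega_poly \<eta> d f .
  have tot: "totient d div 2 = card conjugates" "real (totient d) / 2 = real (card conjugates)"
    using card_conjugates by linarith+
  have "Gal f \<cong> integer_mod_group (card conjugates) \<longleftrightarrow> condition_C d"
    unfolding Gal_cyclic_iff cyclic_mod_pm1_def[symmetric]
    using d condition_C_if_cyclic_mod_pm1 cyclic_mod_pm1_if_condition_C by blast
  then have "cyclic_poly f \<and> Gal f \<cong> integer_mod_group (totient d div 2) \<longleftrightarrow> condition_C d"
    using lead_coeff_f irreducible_f by (auto simp: cyclic_poly_def degree_f tot(1))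
  then show "\<exists>f :: int poly. map_poly of_int f = Omega d \<and>
         irreducible_over_Q f \<and> monogenic f \<and>
         Polynomial.degree f = Coset.order (Gal f) \<and>
         real (Coset.order (Gal f)) = real (totient d) / 2 \<and>
         (cyclic_poly f \<and> Gal f \<cong> integer_mod_group (totient d div 2) \<longleftrightarrow> condition_C d)"
    using f irreducible_f monogenic_f degree_f order_Gal tot(2) by (intro exI[of _ f]) simp
qed

end
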